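(* Let $\Omega\subseteq\mathbb{R}^n$ be a domain and let $p\in\mathcal{P}(\Omega)$ be finite a.e. Consider the functional $\varrho:W^{1,p}(\Omega)\to[0,\infty]$ defined by $$\varrho(u):=\rho_p(|\nabla u|)=\int_\Omega\frac{1}{p(x)}\left(\sum_{j=1}^n\left(\frac{\partial u}{\partial x_j}\right)^2\right)^{\frac{p(x)}{2}}dx=\int_\Omega\frac{1}{p(x)}|\nabla u|^{p(x)}\,dx .$$ Then $\varrho$ is a convex pseudomodular on $W^{1,p}(\Omega)$, and it is $(UC^* )$ provided $p_->1$.
   Context: $\mathcal{P}(\Omega)$ is the family of measurable functions $p:\Omega\to(1,\infty)$ with $p_-:=\inf_{\Omega}p>n$ and $p_+:=\sup_\Omega p=\infty$. For measurable $u$ on $\Omega$, $\rho_p(u)=\int_\Omega\frac{|u(x)|^{p(x)}}{p(x)}\,dx$. For $u$ whose first-order distributional derivatives are functions, $\rho_{1,p}(u)=\rho_p(u)+\rho_p(|\nabla u|)$, with $|\nabla u|$ the Euclidean norm of the gradient, and $W^{1,p}(\Omega)$ is the space of real-valued Borel measurable such $u$ with $\rho_{1,p}(\lambda u)<\infty$ for some $\lambda>0$. A convex pseudomodular on a real vector space $V$ is a function $\rho:V\to[0,\infty]$ with (2) $\rho(\alpha u)=\rho(u)$ if $|\alpha|=1$; (3) $\rho(\alpha u+(1-\alpha)v)\le\alpha\rho(u)+(1-\alpha)\rho(v)$ for all $\alpha\in[0,1]$ and $u,v\in V$. (A convex modular satisfies in addition (1): $\rho(u)=0$ if and only if $u=0$.)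 Such a functional $\rho$ is said to be uniformly convex, written $(UC^* )$, if for every $\varepsilon>0$ there exists $\delta=\delta(\varepsilon)>0$ such that for every $u,v\in V$: $$\rho\left(\frac{u-v}{2}\right)\ge\varepsilon\,\frac{\rho(u)+\rho(v)}{2}\quad\text{implies}\quad\rho\left(\frac{u+v}{2}\right)\le(1-\delta)\,\frac{\rho(u)+\rho(v)}{2}.$$ *)

theory Defs
  imports "HOL-Analysis.Analysis" "HOL-Library.Function_Algebras"
begin

section \<open>Pseudomodulars\<close>

text \<open>Function spaces are sets of functions that are linear subspaces for the pointwise operations.\<close>

instantiation "fun" :: (type, real_vector) real_vector
begin

definition "c *\<^sub>R f = (\<lambda>x. c *\<^sub>R f x)"

instance
  by standard (auto simp: scaleR_fun_def fun_eq_iff algebra_simps)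

end

definition convex_pseudomodular_on :: "'v::real_vector set \<Rightarrow> ('v \<Rightarrow> ennreal) \<Rightarrow> bool" where
  "convex_pseudomodular_on V \<rho> \<longleftrightarrow>
     subspace V \<and>
     (\<forall>u\<in>V. \<forall>\<alpha>::real. \<bar>\<alpha>\<bar> = 1 \<longrightarrow> \<rho> (\<alpha> *\<^sub>R u) = \<rho> u) \<and>
     (\<forall>u\<in>V. \<forall>v\<in>V. \<forall>\<alpha>\<in>{0..1}.
        \<rho> (\<alpha> *\<^sub>R u + (1 - \<alpha>) *\<^sub>R v) \<le> ennreal \<alpha> * \<rho> u + ennreal (1 - \<alpha>) * \<rho> v)"

text \<open>
  The coercion \<open>ennreal (1 - \<delta>)\<close> truncates at 0 for \<open>\<delta> > 1\<close>. This is harmless: a \<open>\<delta> \<ge> 1\<close>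
  that works can be replaced by any smaller positive one.
\<close>

definition UC_star_on :: "'v::real_vector set \<Rightarrow> ('v \<Rightarrow> ennreal) \<Rightarrow> bool" where
  "UC_star_on V \<rho> \<longleftrightarrow>
     (\<forall>\<epsilon>::real. \<epsilon> > 0 \<longrightarrow> (\<exists>\<delta>::real. \<delta> > 0 \<and>
        (\<forall>u\<in>V. \<forall>v\<in>V.
           \<rho> ((1/2) *\<^sub>R (u - v)) \<ge> ennreal \<epsilon> * ((\<rho> u + \<rho> v) / 2) \<longrightarrow>
           \<rho> ((1/2) *\<^sub>R (u + v)) \<le> ennreal (1 - \<delta>) * ((\<rho> u + \<rho> v) / 2))))"


section \<open>Weak derivatives\<close>

definition partial_deriv :: "'n \<Rightarrow> (real ^ 'n \<Rightarrow> real) \<Rightarrow> real ^ 'n \<Rightarrow> real" where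
  "partial_deriv j f x = frechet_derivative f (at x) (axis j 1)"

primrec Ck :: "nat \<Rightarrow> (real ^ 'n \<Rightarrow> real) \<Rightarrow> bool" where
  "Ck 0 f \<longleftrightarrow> continuous_on UNIV f"
| "Ck (Suc k) f \<longleftrightarrow> f differentiable_on UNIV \<and> (\<forall>j. Ck k (partial_deriv j f))"

text \<open>\<open>C\<^sub>c\<^sup>\<infinity>(\<Omega>)\<close>, every function being extended by zero to the whole space.\<close>

definition test_functions :: "(real ^ 'n) set \<Rightarrow> (real ^ 'n \<Rightarrow> real) set" where
  "test_functions \<Omega> =
     {\<phi>. (\<forall>k. Ck k \<phi>) \<and> compact (closure {x. \<phi> x \<noteq> 0}) \<and> closure {x. \<phi> x \<noteq> 0} \<subseteq> \<Omega>}"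

definition locally_integrable_on :: "(real ^ 'n \<Rightarrow> real) \<Rightarrow> (real ^ 'n) set \<Rightarrow> bool"
    (infix "locally'_integrable'_on" 50) where
  "u locally_integrable_on \<Omega> \<longleftrightarrow>
     (\<forall>K. compact K \<and> K \<subseteq> \<Omega> \<longrightarrow> u absolutely_integrable_on K)"

definition has_weak_partial ::
    "(real ^ 'n) set \<Rightarrow> 'n \<Rightarrow> (real ^ 'n \<Rightarrow> real) \<Rightarrow> (real ^ 'n \<Rightarrow> real) \<Rightarrow> bool" where
  "has_weak_partial \<Omega> j u g \<longleftrightarrow>
     u locally_integrable_on \<Omega> \<and> g locally_integrable_on \<Omega> \<and>
     (\<forall>\<phi>\<in>test_functions \<Omega>.
        (LINT x:\<Omega>|lebesgue. u x * partial_deriv j \<phi> x) = - (LINT x:\<Omega>|lebesgue. g x * \<phi> x))"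

text \<open>Weak derivatives are unique up to null sets; one representative is selected.\<close>

definition weak_partial :: "(real ^ 'n) set \<Rightarrow> 'n \<Rightarrow> (real ^ 'n \<Rightarrow> real) \<Rightarrow> real ^ 'n \<Rightarrow> real" where
  "weak_partial \<Omega> j u = (SOME g. has_weak_partial \<Omega> j u g)"

definition weak_gradient :: "(real ^ 'n) set \<Rightarrow> (real ^ 'n \<Rightarrow> real) \<Rightarrow> real ^ 'n \<Rightarrow> real ^ 'n" where
  "weak_gradient \<Omega> u x = (\<chi> j. weak_partial \<Omega> j u x)"


section \<open>Variable exponent spaces\<close>

definition exponent_inf :: "(real ^ 'n) set \<Rightarrow> (real ^ 'n \<Rightarrow> real) \<Rightarrow> ereal" where
  "exponent_inf \<Omega> p = (INF x\<in>\<Omega>. ereal (p x))"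

definition exponent_sup :: "(real ^ 'n) set \<Rightarrow> (real ^ 'n \<Rightarrow> real) \<Rightarrow> ereal" where
  "exponent_sup \<Omega> p = (SUP x\<in>\<Omega>. ereal (p x))"

definition exponents :: "(real ^ 'n) set \<Rightarrow> (real ^ 'n \<Rightarrow> real) set" where
  "exponents \<Omega> =
     {p. p \<in> borel_measurable (lebesgue_on \<Omega>) \<and> (\<forall>x\<in>\<Omega>. 1 < p x) \<and>
         exponent_inf \<Omega> p > ereal (real CARD('n)) \<and> exponent_sup \<Omega> p = \<infinity>}"

definition rho_p ::
    "(real ^ 'n) set \<Rightarrow> (real ^ 'n \<Rightarrow> real) \<Rightarrow> (real ^ 'n \<Rightarrow> real) \<Rightarrow> ennreal" where
  "rho_p \<Omega> p u = (\<integral>\<^sup>+ x. ennreal (\<bar>u x\<bar> powr p x / p x) \<partial>lebesgue_on \<Omega>)"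

definition grad_modular ::
    "(real ^ 'n) set \<Rightarrow> (real ^ 'n \<Rightarrow> real) \<Rightarrow> (real ^ 'n \<Rightarrow> real) \<Rightarrow> ennreal" where
  "grad_modular \<Omega> p u = rho_p \<Omega> p (\<lambda>x. norm (weak_gradient \<Omega> u x))"

definition rho_1p ::
    "(real ^ 'n) set \<Rightarrow> (real ^ 'n \<Rightarrow> real) \<Rightarrow> (real ^ 'n \<Rightarrow> real) \<Rightarrow> ennreal" where
  "rho_1p \<Omega> p u = rho_p \<Omega> p u + rho_p \<Omega> p (\<lambda>x. norm (weak_gradient \<Omega> u x))"

text \<open>
  The elements are functions, not classes modulo null sets; values outside \<open>\<Omega>\<close> are irrelevant.
\<close>

definition W1p :: "(real ^ 'n) set \<Rightarrow> (real ^ 'n \<Rightarrow> real) \<Rightarrow> (real ^ 'n \<Rightarrow> real) set" where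
  "W1p \<Omega> p =
     {u. u \<in> borel_measurable (restrict_space borel \<Omega>) \<and>
         (\<forall>j. \<exists>g. has_weak_partial \<Omega> j u g) \<and>
         (\<exists>c::real. c > 0 \<and> rho_1p \<Omega> p (c *\<^sub>R u) < \<infinity>)}"

lemma grad_modular_eq:
  "grad_modular \<Omega> p u =
     (\<integral>\<^sup>+ x. ennreal (1 / p x * (\<Sum>j\<in>UNIV. (weak_partial \<Omega> j u x)\<^sup>2) powr (p x / 2)) \<partial>lebesgue_on \<Omega>)"
proof -
  have "norm (weak_gradient \<Omega> u x) powr p x =
      (\<Sum>j\<in>UNIV. (weak_partial \<Omega> j u x)\<^sup>2) powr (p x / 2)" for x
  proof -
    have "norm (weak_gradient \<Omega> u x) = (\<Sum>j\<in>UNIV. (weak_partial \<Omega> j u x)\<^sup>2) powr (1/2)"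
      by (simp add: norm_vec_def L2_set_def weak_gradient_def powr_half_sqrt sum_nonneg)
    then show ?thesis by (simp add: powr_powr)
  qed
  then show ?thesis by (simp add: grad_modular_def rho_p_def)
qed

end

theory Submission
  imports Defs
begin

text \<open>
  Convexity and uniform convexity of the gradient modular are integrated forms of pointwise
  inequalities for \<open>\<bar>a\<bar>\<^sup>p\<close> with \<open>a\<close> in a Euclidean space. For \<open>(UC\<^sup>*)\<close> the pointwise inequality is

    \<open>\<bar>(a+b)/2\<bar>\<^sup>p + \<delta> \<bar>(a-b)/2\<bar>\<^sup>p \<le> (1 + \<delta>\<epsilon>) (\<bar>a\<bar>\<^sup>p + \<bar>b\<bar>\<^sup>p)/2\<close>,

  where \<open>\<delta>\<close> depends on \<open>\<epsilon>\<close> and on a lower bound \<open>q > 1\<close> of the exponents, but not on \<open>p \<ge> q\<close>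
  (\<open>norm_powr_uniformly_convex\<close>). Dividing by \<open>p(x)\<close> and integrating it, with \<open>\<epsilon>\<close> replaced by \<open>\<epsilon>/2\<close>,
  gives \<open>\<rho>((u+v)/2) + \<delta> \<rho>((u-v)/2) \<le> (1 + \<delta>\<epsilon>/2) M\<close> with \<open>M = (\<rho>(u) + \<rho>(v))/2\<close>; if
  \<open>\<rho>((u-v)/2) \<ge> \<epsilon> M\<close> and \<open>M\<close> is finite, then \<open>\<rho>((u+v)/2) \<le> (1 - \<delta>\<epsilon>/2) M\<close>. A \<open>\<delta>\<close> that is
  uniform in \<open>p \<ge> q\<close> is essential, because the exponent is unbounded.

  The pointwise inequality needs two ideas. For the single exponent \<open>q\<close>, strict convexity of
  \<open>\<bar>a\<bar>\<^sup>q\<close> and compactness of the set of normalised pairs with \<open>\<bar>a - b\<bar> \<ge> \<epsilon> (\<bar>a\<bar> + \<bar>b\<bar>)\<close> give a gap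
  at the midpoint (\<open>norm_powr_midpoint_uniform\<close>), and Jensen's inequality for the power \<open>p/q \<ge> 1\<close>
  carries the same gap to every \<open>p \<ge> q\<close>. For the remaining pairs \<open>\<bar>a - b\<bar>\<close> is so small that
  \<open>\<bar>(a-b)/2\<bar>\<^sup>p\<close> is at most \<open>\<epsilon>\<close> times the mean of \<open>\<bar>a\<bar>\<^sup>p\<close> and \<open>\<bar>b\<bar>\<^sup>p\<close>.

  To apply these inequalities to functions, the gradient must be linear. Since the weak gradient is a
  chosen representative, it is linear only almost everywhere, and this rests on the uniqueness of
  weak derivatives (\<open>has_weak_partial_unique\<close>), hence on the fundamental lemma of the calculus of
  variations: smooth bumps converge boundedly to the indicator of a box, so a function orthogonal to
  all test functions has integral zero over every box and therefore vanishes almost everywhere. The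
  same linearity makes the Sobolev space a linear subspace, being the modular space of a convex
  pseudomodular on all weakly differentiable functions (\<open>subspace_modular_space\<close>).
\<close>


section \<open>Uniform convexity of powers of the norm\<close>

text \<open>
  Convexity on the open half-line extends to the origin because \<open>s\<^sup>p \<le> s\<close> for \<open>0 \<le> s \<le> 1\<close>.
\<close>

lemma convex_on_powr_nonneg:
  fixes p :: real
  assumes "1 \<le> p"
  shows "convex_on {0..} (\<lambda>t. t powr p)"
proof (rule convex_onI)
  fix t x y :: real
  assume t: "0 < t" "t < 1" and xy: "x \<in> {0..}" "y \<in> {0..}"
  have scale: "(s * z) powr p \<le> s * z powr p" if "0 \<le> s" "s \<le> 1" "0 \<le> z" for s z :: real
  proof -
    have "s powr p \<le> s powr 1"
      using that assms by (intro powr_mono') auto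
    then show ?thesis
      using that by (auto simp: powr_mult intro: mult_right_mono)
  qed
  consider "x = 0" | "y = 0" | "0 < x" "0 < y"
    using xy by fastforce
  then show "((1 - t) *\<^sub>R x + t *\<^sub>R y) powr p \<le> (1 - t) * x powr p + t * y powr p"
  proof cases
    case 3
    then show ?thesis
      using convex_onD[OF powr_convex[OF assms], of t x y] t by simp
  qed (use scale[of t y] scale[of "1 - t" x] t xy in auto)
qed simp

lemma norm_powr_convex:
  fixes a b :: "'a::real_normed_vector"
  assumes "1 \<le> p" "0 \<le> \<alpha>" "\<alpha> \<le> 1"
  shows "norm (\<alpha> *\<^sub>R a + (1 - \<alpha>) *\<^sub>R b) powr p \<le> \<alpha> * norm a powr p + (1 - \<alpha>) * norm b powr p"
proof -
  have "norm (\<alpha> *\<^sub>R a + (1 - \<alpha>) *\<^sub>R b) \<le> \<alpha> * norm a + (1 - \<alpha>) * norm b"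
    using norm_triangle_ineq[of "\<alpha> *\<^sub>R a" "(1 - \<alpha>) *\<^sub>R b"] assms by simp
  then have "norm (\<alpha> *\<^sub>R a + (1 - \<alpha>) *\<^sub>R b) powr p \<le> (\<alpha> * norm a + (1 - \<alpha>) * norm b) powr p"
    using assms by (intro powr_mono2) auto
  also have "\<dots> \<le> \<alpha> * norm a powr p + (1 - \<alpha>) * norm b powr p"
    using convex_onD[OF convex_on_powr_nonneg[OF assms(1)], of \<alpha> "norm b" "norm a"] assms
    by (simp add: algebra_simps)
  finally show ?thesis .
qed

text \<open>
  For fixed \<open>x\<close> the gap at the midpoint vanishes at \<open>y = x\<close> and has, for \<open>y > x\<close>, the derivative
  \<open>q/2 (y\<^bsup>q-1\<^esup> - ((x+y)/2)\<^bsup>q-1\<^esup>) > 0\<close> in \<open>y\<close>.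
\<close>

lemma powr_midpoint_less:
  fixes x y q :: real
  assumes "1 < q" "0 \<le> x" "x < y"
  shows "((x + y) / 2) powr q < (x powr q + y powr q) / 2"
proof -
  define h where "h = (\<lambda>t. (x powr q + t powr q) / 2 - ((x + t) / 2) powr q)"
  have "h x < h y"
  proof (rule DERIV_pos_imp_increasing_open[OF \<open>x < y\<close>])
    fix t assume t: "x < t" "t < y"
    then have pos: "0 < t" "0 < (x + t) / 2"
      using assms by auto
    have "(h has_real_derivative q / 2 * (t powr (q - 1) - ((x + t) / 2) powr (q - 1))) (at t)"
      unfolding h_def using pos
      by (auto intro!: derivative_eq_intros simp: algebra_simps)
    moreover have "((x + t) / 2) powr (q - 1) < t powr (q - 1)"
      using assms pos t by (intro powr_less_mono2) auto
    ultimately show "\<exists>D. (h has_real_derivative D) (at t) \<and> 0 < D"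
      using assms by (intro exI conjI) auto
  next
    show "continuous_on {x..y} h"
      unfolding h_def using assms by (intro continuous_intros continuous_on_powr') auto
  qed
  then show ?thesis
    using assms by (simp add: h_def)
qed

text \<open>
  If the norms differ, the power \<open>t\<^sup>q\<close> is strictly convex between them; if they agree, the triangle
  inequality is strict.
\<close>

lemma norm_powr_midpoint_less:
  fixes a b :: "'a::real_inner"
  assumes "1 < q" "a \<noteq> b"
  shows "norm ((1/2) *\<^sub>R (a + b)) powr q < (norm a powr q + norm b powr q) / 2"
proof (cases "norm a = norm b")
  case True
  have "norm (a + b) \<noteq> norm a + norm b"
  proof
    assume "norm (a + b) = norm a + norm b"
    then have "norm a *\<^sub>R b = norm b *\<^sub>R a"
      using norm_triangle_eq by blast
    then show False
      using assms True by auto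
  qed
  then have "norm ((1/2) *\<^sub>R (a + b)) < norm a"
    using norm_triangle_ineq[of a b] True by simp
  then show ?thesis
    using assms True by (simp add: powr_less_mono2)
next
  case False
  have "norm ((1/2) *\<^sub>R (a + b)) powr q \<le> ((norm a + norm b) / 2) powr q"
    using assms norm_triangle_ineq[of a b] by (intro powr_mono2) auto
  also have "\<dots> < (norm a powr q + norm b powr q) / 2"
    using powr_midpoint_less[of q "norm a" "norm b"] powr_midpoint_less[of q "norm b" "norm a"]
      False assms by (cases "norm a < norm b") (auto simp: add.commute)
  finally show ?thesis .
qed

text \<open>
  By homogeneity it suffices to consider pairs with \<open>\<bar>a\<bar> + \<bar>b\<bar> = 1\<close>. Those with \<open>\<bar>a - b\<bar> \<ge> \<eta>\<close> form a compact set
  on which the quotient of the two sides is continuous and less than 1, so its maximum is less than 1.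
\<close>

lemma norm_powr_midpoint_uniform:
  fixes q \<eta> :: real
  assumes "1 < q" "0 < \<eta>"
  obtains \<delta> where "0 < \<delta>" "\<delta> < 1"
    "\<And>(a::'a::euclidean_space) b. \<eta> * (norm a + norm b) \<le> norm (a - b) \<Longrightarrow>
       norm ((1/2) *\<^sub>R (a + b)) powr q \<le> (1 - \<delta>) * ((norm a powr q + norm b powr q) / 2)"
proof -
  define K where "K = {z::'a \<times> 'a. norm (fst z) + norm (snd z) = 1 \<and> \<eta> \<le> norm (fst z - snd z)}"
  define R where "R = (\<lambda>z::'a \<times> 'a. norm ((1/2) *\<^sub>R (fst z + snd z)) powr q /
    ((norm (fst z) powr q + norm (snd z) powr q) / 2))"
  have neq: "fst z \<noteq> snd z" if "z \<in> K" for z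
    using that assms by (auto simp: K_def)
  have mean_pos: "0 < norm (fst z) powr q + norm (snd z) powr q" if "z \<in> K" for z
  proof -
    have "fst z \<noteq> 0 \<or> snd z \<noteq> 0"
      using that by (auto simp: K_def)
    then show ?thesis
      by (auto intro: add_pos_nonneg add_nonneg_pos)
  qed
  have R_less: "R z < 1" if "z \<in> K" for z
    using norm_powr_midpoint_less[OF assms(1) neq[OF that]] mean_pos[OF that]
    by (simp add: R_def divide_less_eq)
  have "closed K"
    unfolding K_def
    by (intro closed_Collect_conj closed_Collect_eq closed_Collect_le continuous_intros)
  moreover have "bounded K"
  proof (rule boundedI)
    fix z assume "z \<in> K"
    then show "norm z \<le> 1"
      using norm_triangle_ineq[of "(fst z, 0)" "(0, snd z)"] by (simp add: K_def norm_Pair)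
  qed
  ultimately have "compact K"
    using compact_eq_bounded_closed by blast
  have cont: "continuous_on K R"
  proof -
    have "norm (fst z) powr q + norm (snd z) powr q \<noteq> 0" if "z \<in> K" for z
      using mean_pos[OF that] by simp
    then show ?thesis
      unfolding R_def using assms by (intro continuous_intros continuous_on_powr') auto
  qed
  obtain m where m: "m < 1" "\<And>z. z \<in> K \<Longrightarrow> R z \<le> m"
  proof (cases "K = {}")
    case True
    then show ?thesis using that[of 0] by auto
  next
    case False
    then show ?thesis
      using continuous_attains_sup[OF \<open>compact K\<close> _ cont] R_less that by metis
  qed
  \<comment> \<open>Taking \<open>max m 0\<close> and halving keeps \<open>\<delta>\<close> strictly between 0 and 1 with \<open>m \<le> 1 - \<delta>\<close>.\<close>
  define \<delta> where "\<delta> = (1 - max m 0) / 2"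
  show ?thesis
  proof (rule that[of \<delta>])
    show "0 < \<delta>" "\<delta> < 1"
      using m by (auto simp: \<delta>_def)
    fix a b :: 'a
    assume ab: "\<eta> * (norm a + norm b) \<le> norm (a - b)"
    show "norm ((1/2) *\<^sub>R (a + b)) powr q \<le> (1 - \<delta>) * ((norm a powr q + norm b powr q) / 2)"
    proof (cases "norm a + norm b = 0")
      case True
      then have "a = 0" "b = 0"
        by (metis add_nonneg_eq_0_iff norm_eq_zero norm_ge_zero)+
      then show ?thesis by simp
    next
      case False
      define r where "r = norm a + norm b"
      have r: "0 < r"
        using False norm_ge_zero[of a] norm_ge_zero[of b] by (simp add: r_def less_le)
      define a' where "a' = (1/r) *\<^sub>R a"
      define b' where "b' = (1/r) *\<^sub>R b"
      have scaled: "a = r *\<^sub>R a'" "b = r *\<^sub>R b'"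
        using r by (auto simp: a'_def b'_def)
      have "norm (a - b) = r * norm (a' - b')"
        using r by (simp add: scaled flip: scaleR_diff_right)
      then have "\<eta> \<le> norm (a' - b')"
        using ab r by (simp add: mult.commute flip: r_def)
      moreover have "norm a' + norm b' = 1"
        using r by (simp add: a'_def b'_def r_def flip: add_divide_distrib)
      ultimately have "(a', b') \<in> K"
        by (simp add: K_def)
      then have "norm ((1/2) *\<^sub>R (a' + b')) powr q \<le> m * ((norm a' powr q + norm b' powr q) / 2)"
        using m(2) mean_pos by (fastforce simp: R_def divide_le_eq)
      also have "\<dots> \<le> (1 - \<delta>) * ((norm a' powr q + norm b' powr q) / 2)"
        using m(1) by (intro mult_right_mono) (auto simp: \<delta>_def max_def field_simps)
      finally have "r powr q * norm ((1/2) *\<^sub>R (a' + b')) powr q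
          \<le> r powr q * ((1 - \<delta>) * ((norm a' powr q + norm b' powr q) / 2))"
        by (rule mult_left_mono) simp
      moreover have "norm ((1/2) *\<^sub>R (a + b)) = r * norm ((1/2) *\<^sub>R (a' + b'))"
        using r by (simp add: scaled flip: scaleR_add_right)
      moreover have "norm a = r * norm a'" "norm b = r * norm b'"
        using r by (auto simp: scaled)
      ultimately show ?thesis
        using r by (simp add: powr_mult algebra_simps)
    qed
  qed
qed

text \<open>
  If \<open>\<epsilon> (\<bar>a\<bar> + \<bar>b\<bar>) \<le> \<bar>a - b\<bar>\<close>, the gap for the exponent \<open>q\<close> survives the power \<open>p/q \<ge> 1\<close>, since
  \<open>(1 - \<delta>)\<^bsup>p/q\<^esup> \<le> 1 - \<delta>\<close>, and it pays for the term \<open>\<delta> \<bar>(a-b)/2\<bar>\<^sup>p\<close>. Otherwise that term is itself at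
  most \<open>\<delta>\<epsilon>\<close> times the mean. In neither case does \<open>\<delta>\<close> depend on \<open>p\<close>.
\<close>

lemma norm_powr_uniformly_convex:
  fixes q \<epsilon> :: real
  assumes "1 < q" "0 < \<epsilon>" "\<epsilon> \<le> 1"
  obtains \<delta> where "0 < \<delta>" "\<delta> < 1"
    "\<And>(a::'a::euclidean_space) b p. q \<le> p \<Longrightarrow>
       norm ((1/2) *\<^sub>R (a + b)) powr p + \<delta> * norm ((1/2) *\<^sub>R (a - b)) powr p
         \<le> (1 + \<delta> * \<epsilon>) * ((norm a powr p + norm b powr p) / 2)"
proof -
  obtain \<delta> where \<delta>: "0 < \<delta>" "\<delta> < 1"
    "\<And>(a::'a) b. \<epsilon> * (norm a + norm b) \<le> norm (a - b) \<Longrightarrow>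
       norm ((1/2) *\<^sub>R (a + b)) powr q \<le> (1 - \<delta>) * ((norm a powr q + norm b powr q) / 2)"
    using norm_powr_midpoint_uniform[OF assms(1,2)] by blast
  show ?thesis
  proof (rule that[OF \<delta>(1,2)])
    fix a b :: 'a and p :: real
    assume "q \<le> p"
    then have p: "1 \<le> p" "1 \<le> p / q" "0 < p"
      using assms by auto
    define M where "M = (norm a powr p + norm b powr p) / 2"
    have "0 \<le> M" by (simp add: M_def)
    have half: "((s + t) / 2) powr r \<le> (s powr r + t powr r) / 2" 
      if "0 \<le> s" "0 \<le> t" "1 \<le> r" for s t r :: real
      using convex_onD[OF convex_on_powr_nonneg[OF that(3)], of "1/2" s t] that
      by (simp add: add_divide_distrib)
    have mean: "((norm a + norm b) / 2) powr p \<le> M"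
      unfolding M_def using p by (intro half) auto
    have plus: "norm ((1/2) *\<^sub>R (a + b)) powr p \<le> M"
      using mean powr_mono2[of p "norm ((1/2) *\<^sub>R (a + b))" "(norm a + norm b) / 2"]
        norm_triangle_ineq[of a b] p by simp
    have minus: "norm ((1/2) *\<^sub>R (a - b)) powr p \<le> M"
      using mean powr_mono2[of p "norm ((1/2) *\<^sub>R (a - b))" "(norm a + norm b) / 2"]
        norm_triangle_ineq4[of a b] p by simp
    show "norm ((1/2) *\<^sub>R (a + b)) powr p + \<delta> * norm ((1/2) *\<^sub>R (a - b)) powr p
         \<le> (1 + \<delta> * \<epsilon>) * ((norm a powr p + norm b powr p) / 2)"
    proof (cases "\<epsilon> * (norm a + norm b) \<le> norm (a - b)")
      case True
      define A where "A = (norm a powr q + norm b powr q) / 2"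
      have "norm ((1/2) *\<^sub>R (a + b)) powr p = (norm ((1/2) *\<^sub>R (a + b)) powr q) powr (p / q)"
        using assms by (simp add: powr_powr)
      also have "\<dots> \<le> ((1 - \<delta>) * A) powr (p / q)"
        using \<delta>(3)[OF True] p by (intro powr_mono2) (auto simp: A_def)
      also have "\<dots> = (1 - \<delta>) powr (p / q) * A powr (p / q)"
        using \<delta>(1,2) by (simp only: powr_mult)
      also have "\<dots> \<le> (1 - \<delta>) powr 1 * M"
      proof (rule mult_mono)
        show "(1 - \<delta>) powr (p / q) \<le> (1 - \<delta>) powr 1"
          using \<delta> p by (intro powr_mono') auto
        show "A powr (p / q) \<le> M"
          using half[of "norm a powr q" "norm b powr q" "p / q"] p assms
          by (simp add: A_def M_def powr_powr)
      qed (use \<delta> in auto)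
      finally have "norm ((1/2) *\<^sub>R (a + b)) powr p \<le> (1 - \<delta>) * M"
        using \<delta> by simp
      moreover have "\<delta> * norm ((1/2) *\<^sub>R (a - b)) powr p \<le> \<delta> * M"
        using minus \<delta> by simp
      moreover have "0 \<le> \<delta> * \<epsilon> * M"
        using \<delta> assms \<open>0 \<le> M\<close> by simp
      ultimately show ?thesis
        by (simp add: algebra_simps flip: M_def)
    next
      case False
      have "norm ((1/2) *\<^sub>R (a - b)) powr p \<le> (\<epsilon> * ((norm a + norm b) / 2)) powr p"
        using False p by (intro powr_mono2) auto
      also have "\<dots> = \<epsilon> powr p * ((norm a + norm b) / 2) powr p"
        by (simp only: powr_mult)
      also have "\<dots> \<le> \<epsilon> powr 1 * M"
        using mean assms p by (intro mult_mono powr_mono') auto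
      finally have "\<delta> * norm ((1/2) *\<^sub>R (a - b)) powr p \<le> \<delta> * (\<epsilon> * M)"
        using \<delta> assms by simp
      then show ?thesis
        using plus by (simp add: algebra_simps flip: M_def)
    qed
  qed
qed


section \<open>Smooth bumps on boxes\<close>

text \<open>
  The smooth functions \<open>P(1/t) e\<^bsup>-1/t\<^esup>\<close>, extended by zero to \<open>t \<le> 0\<close>. Polynomial factors are
  included so that the family is closed under differentiation.
\<close>

definition flat_exp :: "real poly \<Rightarrow> real \<Rightarrow> real" where
  "flat_exp P t = (if 0 < t then poly P (1 / t) * exp (- (1 / t)) else 0)"

lemma tendsto_flat_exp_0: "(flat_exp P \<longlongrightarrow> 0) (at_right 0)"
proof -
  have "((\<lambda>s. poly P s / exp s) \<longlongrightarrow> (\<Sum>i\<le>degree P. coeff P i * 0)) at_top"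
    unfolding poly_altdef sum_divide_distrib times_divide_eq_right[symmetric]
    by (intro tendsto_intros tendsto_power_div_exp_0)
  then have "((\<lambda>t. poly P (inverse t) / exp (inverse t)) \<longlongrightarrow> 0) (at_right 0)"
    using filterlim_compose[OF _ filterlim_inverse_at_top_right] by simp
  moreover have "eventually (\<lambda>t::real. 0 < t) (at_right 0)"
    by (simp add: eventually_at_right_less)
  then have "eventually (\<lambda>t. poly P (inverse t) / exp (inverse t) = flat_exp P t) (at_right 0)"
    by eventually_elim (simp add: flat_exp_def exp_minus divide_simps)
  ultimately show ?thesis
    by (rule Lim_transform_eventually)
qed

text \<open>
  The polynomial \<open>X\<^sup>2 (P - P')\<close> comes from differentiating at \<open>t > 0\<close>. At the origin the difference
  quotient is again a member of the family, with the polynomial \<open>X P\<close>, and tends to zero.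
\<close>

lemma flat_exp_has_derivative:
  "(flat_exp P has_real_derivative flat_exp ([:0, 0, 1:] * (P - pderiv P)) t) (at t)"
proof -
  consider "t < 0" | "0 < t" | "t = 0" by linarith
  then show ?thesis
  proof cases
    case 1
    have "((\<lambda>_. 0) has_real_derivative 0) (at t)" by simp
    moreover have "eventually (\<lambda>s. 0 = flat_exp P s) (nhds t)"
      using eventually_nhds_in_open[of "{..<0}" t] 1
      by (auto simp: flat_exp_def elim!: eventually_mono)
    ultimately have "(flat_exp P has_real_derivative 0) (at t)"
      by (simp cong: DERIV_cong_ev)
    then show ?thesis
      using 1 by (simp add: flat_exp_def)
  next
    case 2
    have "((\<lambda>s. poly P (1 / s) * exp (- (1 / s))) has_real_derivative
        poly ([:0, 0, 1:] * (P - pderiv P)) (1 / t) * exp (- (1 / t))) (at t)"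
      using 2
      by (auto intro!: derivative_eq_intros DERIV_chain'[where g = "poly P"]
          simp: field_simps power2_eq_square simp del: mult_pCons_left)
    moreover have "eventually (\<lambda>s. poly P (1 / s) * exp (- (1 / s)) = flat_exp P s) (nhds t)"
      using eventually_nhds_in_open[of "{0<..}" t] 2
      by (auto simp: flat_exp_def elim!: eventually_mono)
    ultimately have "(flat_exp P has_real_derivative 
        poly ([:0, 0, 1:] * (P - pderiv P)) (1 / t) * exp (- (1 / t))) (at t)"
      by (rule DERIV_cong_ev[OF refl _ refl, THEN iffD1, rotated])
    then show ?thesis
      using 2 by (simp add: flat_exp_def)
  next
    case 3
    have "((\<lambda>h. flat_exp P h / h) \<longlongrightarrow> 0) (at_right 0)"
    proof (rule Lim_transform_eventually)
      show "(flat_exp ([:0, 1:] * P) \<longlongrightarrow> 0) (at_right 0)"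
        by (rule tendsto_flat_exp_0)
      show "eventually (\<lambda>h. flat_exp ([:0, 1:] * P) h = flat_exp P h / h) (at_right 0)"
        using eventually_at_right_less[of 0]
        by eventually_elim (simp add: flat_exp_def)
    qed
    moreover have "((\<lambda>h. flat_exp P h / h) \<longlongrightarrow> 0) (at_left 0)"
      by (rule Lim_transform_eventually[OF tendsto_const])
        (use eventually_at_left_real[of "-1" 0] in \<open>auto simp: flat_exp_def elim!: eventually_mono\<close>)
    ultimately have "((\<lambda>h. flat_exp P h / h) \<longlongrightarrow> 0) (at 0)"
      by (simp add: filterlim_at_split)
    then show ?thesis
      using 3 by (simp add: DERIV_def flat_exp_def)
  qed
qed

lemma has_partial_derivI:
  fixes f :: "real ^ 'n \<Rightarrow> real"
  assumes "(f has_derivative f') (at x)"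
  shows "partial_deriv j f x = f' (axis j 1)"
  using assms by (simp add: partial_deriv_def flip: frechet_derivative_at)

lemma Ck_Suc_imp_Ck: "Ck (Suc k) f \<Longrightarrow> Ck k f"
proof (induction k arbitrary: f)
  case 0
  then show ?case by (simp add: differentiable_imp_continuous_on)
next
  case (Suc k)
  then show ?case by (metis Ck.simps(2))
qed

text \<open>
  Induction on the order of smoothness works because a partial derivative stays within the family:
  the chain rule factor \<open>c\<close>, or zero for the other coordinates, is absorbed into the polynomial.
\<close>

lemma Ck_flat_exp: "Ck k (\<lambda>x::real ^ 'n. flat_exp P (c * (x $ i) + d))"
proof (induction k arbitrary: P)
  case base: 0
  have "continuous_on UNIV (flat_exp P)"
    using flat_exp_has_derivative DERIV_isCont by (blast intro: continuous_at_imp_continuous_on)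
  then show ?case
    by (auto intro!: continuous_intros continuous_on_compose2[of UNIV "flat_exp P"])
next
  case (Suc k)
  define Q where "Q = [:0, 0, 1:] * (P - pderiv P)"
  have smult: "flat_exp (smult s Q) t = s * flat_exp Q t" for s t
    by (simp add: flat_exp_def)
  have der: "((\<lambda>x::real ^ 'n. flat_exp P (c * (x $ i) + d)) has_derivative
      (\<lambda>h. flat_exp Q (c * (x $ i) + d) * (c * (h $ i)))) (at x)" for x
  proof -
    have "(flat_exp P has_derivative (\<lambda>h. flat_exp Q (c * (x $ i) + d) * h)) (at (c * (x $ i) + d))"
      using flat_exp_has_derivative[of P "c * (x $ i) + d"]
      by (simp add: has_field_derivative_def Q_def mult_commute_abs)
    moreover have "((\<lambda>x::real ^ 'n. c * (x $ i) + d) has_derivative (\<lambda>h. c * (h $ i))) (at x)"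
      by (auto intro!: derivative_eq_intros bounded_linear_imp_has_derivative bounded_linear_vec_nth)
    ultimately show ?thesis
      using diff_chain_at by (fastforce simp: o_def)
  qed
  have "partial_deriv j (\<lambda>x::real ^ 'n. flat_exp P (c * (x $ i) + d)) =
      (\<lambda>x. flat_exp (smult (if i = j then c else 0) Q) (c * (x $ i) + d))" for j
    by (rule ext) (simp add: has_partial_derivI[OF der] smult axis_def)
  moreover have "(\<lambda>x::real ^ 'n. flat_exp P (c * (x $ i) + d)) differentiable_on UNIV"
    using der by (auto simp: differentiable_on_def differentiable_def)
  ultimately show ?case
    using Suc.IH by simp
qed

lemma Ck_add: "Ck k f \<Longrightarrow> Ck k g \<Longrightarrow> Ck k (\<lambda>x. f x + g x)"
proof (induction k arbitrary: f g)
  case 0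
  then show ?case by (simp add: continuous_on_add)
next
  case (Suc k)
  have "partial_deriv j (\<lambda>x. f x + g x) = (\<lambda>x. partial_deriv j f x + partial_deriv j g x)" for j
  proof
    fix x
    have "f differentiable (at x)" "g differentiable (at x)"
      using Suc.prems by (auto simp: differentiable_on_def)
    then have "((\<lambda>x. f x + g x) has_derivative
        (\<lambda>h. frechet_derivative f (at x) h + frechet_derivative g (at x) h)) (at x)"
      by (intro has_derivative_add) (simp_all add: frechet_derivative_works)
    then show "partial_deriv j (\<lambda>x. f x + g x) x = partial_deriv j f x + partial_deriv j g x"
      using has_partial_derivI by (simp add: partial_deriv_def flip: frechet_derivative_at)
  qed
  then show ?case
    using Suc by (auto intro: differentiable_on_add)
qed

lemma Ck_mult: "Ck k f \<Longrightarrow> Ck k g \<Longrightarrow> Ck k (\<lambda>x. f x * g x)"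
proof (induction k arbitrary: f g)
  case 0
  then show ?case by (simp add: continuous_on_mult)
next
  case (Suc k)
  have "partial_deriv j (\<lambda>x. f x * g x) =
      (\<lambda>x. f x * partial_deriv j g x + partial_deriv j f x * g x)" for j
  proof
    fix x
    have "f differentiable (at x)" "g differentiable (at x)"
      using Suc.prems by (auto simp: differentiable_on_def)
    then have "((\<lambda>x. f x * g x) has_derivative
        (\<lambda>h. f x * frechet_derivative g (at x) h + frechet_derivative f (at x) h * g x)) (at x)"
      by (intro has_derivative_mult) (simp_all add: frechet_derivative_works)
    then show "partial_deriv j (\<lambda>x. f x * g x) x = f x * partial_deriv j g x + partial_deriv j f x * g x"
      using has_partial_derivI by (simp add: partial_deriv_def flip: frechet_derivative_at)
  qed
  then show ?case
    using Suc.prems Ck_Suc_imp_Ck[OF Suc.prems(1)] Ck_Suc_imp_Ck[OF Suc.prems(2)]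
    by (auto intro!: differentiable_on_mult Ck_add Suc.IH)
qed

lemma Ck_const: "Ck k (\<lambda>x::real ^ 'n. c)"
proof (induction k arbitrary: c)
  case (Suc k)
  have "partial_deriv j (\<lambda>x::real ^ 'n. c) = (\<lambda>x. 0)" for j
    by (rule ext) (simp add: partial_deriv_def)
  then show ?case
    using Suc by simp
qed simp

lemma Ck_prod: "(\<And>i. i \<in> I \<Longrightarrow> Ck k (f i)) \<Longrightarrow> Ck k (\<lambda>x. \<Prod>i\<in>I. f i x)"
  by (induction I rule: infinite_finite_induct) (auto intro: Ck_mult Ck_const)

text \<open>
  The scaling by \<open>m\<close> inside the exponential leaves the support unchanged while \<open>e\<^bsup>-1/(ms)\<^esup> \<rightarrow> 1\<close> for
  every \<open>s > 0\<close>, so these bumps tend to the indicator of the box without any mollification. The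
  arguments are written in the form \<open>c x\<^sub>i + d\<close> to match \<open>Ck_flat_exp\<close>.
\<close>

definition box_bump :: "real ^ 'n \<Rightarrow> real ^ 'n \<Rightarrow> nat \<Rightarrow> real ^ 'n \<Rightarrow> real" where
  "box_bump a b m x = (\<Prod>i\<in>UNIV.
     flat_exp 1 (real m * (x $ i) + - real m * (a $ i)) *
     flat_exp 1 (- real m * (x $ i) + real m * (b $ i)))"

lemma flat_exp_1_bounds: "0 \<le> flat_exp 1 t" "flat_exp 1 t \<le> 1"
  by (auto simp: flat_exp_def)

lemma box_bump_bounds: "0 \<le> box_bump a b m x" "box_bump a b m x \<le> 1"
  unfolding box_bump_def
  by (auto intro!: prod_nonneg prod_le_1 mult_le_one simp: flat_exp_1_bounds)

lemma box_bump_outside: "x \<notin> box a b \<Longrightarrow> box_bump a b m x = 0"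
proof -
  assume "x \<notin> box a b"
  then obtain i where "\<not> (a $ i < x $ i \<and> x $ i < b $ i)"
    by (auto simp: mem_box_cart)
  then have "\<not> 0 < real m * (x $ i - a $ i) \<or> \<not> 0 < real m * (b $ i - x $ i)"
    by (auto simp: zero_less_mult_iff)
  then have "flat_exp 1 (real m * (x $ i) + - real m * (a $ i)) *
     flat_exp 1 (- real m * (x $ i) + real m * (b $ i)) = 0"
    by (auto simp: flat_exp_def algebra_simps)
  then show ?thesis
    unfolding box_bump_def by (meson UNIV_I finite_UNIV prod_zero finite)
qed

lemma box_bump_test_function:
  assumes "cbox a b \<subseteq> \<Omega>"
  shows "box_bump a b m \<in> test_functions \<Omega>"
proof -
  have "{x. box_bump a b m x \<noteq> 0} \<subseteq> cbox a b"
    using box_bump_outside box_subset_cbox by blast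
  then have supp: "closure {x. box_bump a b m x \<noteq> 0} \<subseteq> cbox a b"
    by (intro closure_minimal) auto
  then have "compact (closure {x. box_bump a b m x \<noteq> 0})"
    by (meson bounded_cbox bounded_subset closed_closure compact_eq_bounded_closed)
  moreover have "Ck k (box_bump a b m)" for k
    unfolding box_bump_def by (intro Ck_prod Ck_mult Ck_flat_exp)
  ultimately show ?thesis
    using supp assms by (auto simp: test_functions_def)
qed

lemma tendsto_box_bump: "(\<lambda>m. box_bump a b m x) \<longlonglongrightarrow> indicator (box a b) x"
proof (cases "x \<in> box a b")
  case False
  then show ?thesis by (simp add: box_bump_outside)
next
  case True
  have flat: "(\<lambda>m. flat_exp 1 (real m * s)) \<longlonglongrightarrow> 1" if "0 < s" for s
  proof (rule Lim_transform_eventually)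
    have "(\<lambda>m. exp (- (1 / s * (1 / real m)))) \<longlonglongrightarrow> exp (- (1 / s * 0))"
      by (intro tendsto_intros lim_1_over_n)
    then show "(\<lambda>m. exp (- (1 / s * (1 / real m)))) \<longlonglongrightarrow> 1" by simp
    show "eventually (\<lambda>m. exp (- (1 / s * (1 / real m))) = flat_exp 1 (real m * s)) sequentially"
      using eventually_gt_at_top[of 0]
      by eventually_elim (use that in \<open>simp add: flat_exp_def mult.commute\<close>)
  qed
  have "(\<lambda>m. \<Prod>i\<in>UNIV. flat_exp 1 (real m * (x $ i - a $ i)) * flat_exp 1 (real m * (b $ i - x $ i)))
      \<longlonglongrightarrow> (\<Prod>i\<in>(UNIV::'a set). 1 * 1)"
    using True by (intro tendsto_intros flat) (auto simp: mem_box_cart)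
  then show ?thesis
    using True by (simp add: box_bump_def algebra_simps)
qed


section \<open>Uniqueness of weak derivatives and linearity of the gradient\<close>

lemma test_function_support:
  assumes "\<phi> \<in> test_functions \<Omega>"
  obtains K where "compact K" "K \<subseteq> \<Omega>" "\<And>x. x \<notin> K \<Longrightarrow> \<phi> x = 0"
proof (rule that[of "closure {x. \<phi> x \<noteq> 0}"])
  show "\<And>x. x \<notin> closure {x. \<phi> x \<noteq> 0} \<Longrightarrow> \<phi> x = 0"
    using closure_subset[of "{x. \<phi> x \<noteq> 0}"] by blast
qed (use assms in \<open>auto simp: test_functions_def\<close>)

lemma test_function_continuous: "\<phi> \<in> test_functions \<Omega> \<Longrightarrow> continuous_on S \<phi>"
proof -
  assume "\<phi> \<in> test_functions \<Omega>"
  then have "Ck 0 \<phi>"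
    unfolding test_functions_def by blast
  then show ?thesis
    using continuous_on_subset by (simp, blast)
qed

lemma partial_deriv_test_function:
  assumes "\<phi> \<in> test_functions \<Omega>"
  shows "partial_deriv j \<phi> \<in> test_functions \<Omega>"
proof -
  let ?S = "closure {x. \<phi> x \<noteq> 0}"
  have outside: "partial_deriv j \<phi> x = 0" if "x \<notin> ?S" for x
  proof -
    have "open (- ?S)" "x \<in> - ?S"
      using that by auto
    moreover have "\<phi> y = 0" if "y \<in> - ?S" for y
      using that closure_subset[of "{x. \<phi> x \<noteq> 0}"] by blast
    ultimately have "(\<phi> has_derivative (\<lambda>_. 0)) (at x)"
      using has_derivative_transform_within_open[OF has_derivative_const, of "- ?S" x 0 \<phi> UNIV]
      by metis
    then show ?thesis
      by (rule has_partial_derivI)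
  qed
  have supp: "closure {x. partial_deriv j \<phi> x \<noteq> 0} \<subseteq> ?S"
    using outside by (intro closure_minimal) auto
  moreover have S: "compact ?S" "?S \<subseteq> \<Omega>"
    using assms by (auto simp: test_functions_def)
  moreover have "compact (closure {x. partial_deriv j \<phi> x \<noteq> 0})"
    using supp S(1) by (meson bounded_subset closed_closure compact_eq_bounded_closed)
  moreover have "Ck k (partial_deriv j \<phi>)" for k
  proof -
    have "Ck (Suc k) \<phi>"
      using assms unfolding test_functions_def by blast
    then show ?thesis by simp
  qed
  ultimately show ?thesis
    unfolding test_functions_def by blast
qed

lemma set_integrable_mult_test_function:
  assumes "u locally_integrable_on \<Omega>" "\<phi> \<in> test_functions \<Omega>"
  shows "set_integrable lebesgue \<Omega> (\<lambda>x. u x * \<phi> x)"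
proof -
  obtain K where K: "compact K" "K \<subseteq> \<Omega>" "\<And>x. x \<notin> K \<Longrightarrow> \<phi> x = 0"
    using test_function_support[OF assms(2)] by blast
  have lebK: "K \<in> sets lebesgue"
    using K(1) by (simp add: compact_imp_closed)
  have "(\<lambda>x. \<phi> x * u x) absolutely_integrable_on K"
  proof (rule absolutely_integrable_bounded_measurable_product[OF bilinear_times _ lebK])
    show "\<phi> \<in> borel_measurable (lebesgue_on K)"
      using test_function_continuous[OF assms(2)] lebK
      by (intro continuous_imp_measurable_on_sets_lebesgue)
    show "bounded (\<phi> ` K)"
      using test_function_continuous[OF assms(2)] K(1)
      by (intro compact_imp_bounded compact_continuous_image)
    show "u absolutely_integrable_on K"
      using assms(1) K by (simp add: locally_integrable_on_def)
  qed
  moreover have "indicator K x *\<^sub>R (\<phi> x * u x) = indicator \<Omega> x *\<^sub>R (u x * \<phi> x)" for x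
    using K(2,3) by (auto simp: indicator_def)
  ultimately show ?thesis
    by (simp only: set_integrable_def)
qed

text \<open>
  The bumps of the intersection are test functions on every set that contains \<open>cbox c d\<close>, because its
  closed counterpart stays within \<open>cbox c d\<close>.
\<close>

lemma box_Int_box_cbox:
  fixes a :: "'a::euclidean_space"
  obtains e f where "box a b \<inter> box c d = box e f" "cbox e f \<subseteq> cbox c d"
proof
  show "box a b \<inter> box c d =
      box (\<Sum>i\<in>Basis. max (a \<bullet> i) (c \<bullet> i) *\<^sub>R i) (\<Sum>i\<in>Basis. min (b \<bullet> i) (d \<bullet> i) *\<^sub>R i)"
    by (rule box_Int_box)
  show "cbox (\<Sum>i\<in>Basis. max (a \<bullet> i) (c \<bullet> i) *\<^sub>R i) (\<Sum>i\<in>Basis. min (b \<bullet> i) (d \<bullet> i) *\<^sub>R i)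
      \<subseteq> cbox c d"
    by (auto simp: mem_box)
qed

text \<open>
  Boxes form a generator of the Borel sets that is stable under intersection, so the integral vanishes
  over all Borel sets. A Lebesgue set differs from a Borel set by a null set.
\<close>

lemma AE_zero_if_integral_box_zero:
  fixes f :: "'a::euclidean_space \<Rightarrow> real"
  assumes f: "integrable lebesgue f"
    and zero: "(LINT x|lebesgue. f x) = 0"
    and box: "\<And>a b. (LINT x:box a b|lebesgue. f x) = 0"
  shows "AE x in lebesgue. f x = 0"
proof -
  let ?G = "range (\<lambda>(a, b). box a b :: 'a set)"
  have leb: "set_integrable lebesgue A f" if "A \<in> sets lebesgue" for A
    unfolding set_integrable_def using that f by (rule integrable_mult_indicator)
  have borel_sets: "sets (borel :: 'a measure) = sigma_sets UNIV ?G"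
    by (simp add: borel_eq_box)
  have borel: "(LINT x:A|lebesgue. f x) = 0" if "A \<in> sets borel" for A
  proof -
    have "Int_stable ?G"
      by (auto simp: Int_stable_def box_Int_box)
    moreover have "?G \<subseteq> Pow UNIV" by simp
    moreover have "A \<in> sigma_sets UNIV ?G"
      using that borel_sets by simp
    ultimately show ?thesis
    proof (induction rule: sigma_sets_induct_disjoint)
      case (basic A)
      then show ?case using box by auto
    next
      case empty
      then show ?case by (simp add: set_lebesgue_integral_def)
    next
      case (compl A)
      then have A: "A \<in> sets lebesgue"
        by (simp flip: borel_sets)
      have "(LINT x:UNIV|lebesgue. f x) = (LINT x:A|lebesgue. f x) + (LINT x:UNIV - A|lebesgue. f x)"
        using A sets.compl_sets[OF A] set_integral_Un[of A "UNIV - A" lebesgue f] leb by auto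
      then show ?case
        using compl zero by (simp add: set_lebesgue_integral_def)
    next
      case (union A)
      then have A: "A i \<in> sets lebesgue" for i
        by (auto simp flip: borel_sets)
      have "(LINT x:(\<Union>i. A i)|lebesgue. f x) = (\<Sum>i. (LINT x:(A i)|lebesgue. f x))"
        using union.hyps(1) A
        by (intro lebesgue_integral_countable_add leb) (auto simp: disjoint_family_on_def)
      then show ?case
        using union by simp
    qed
  qed
  have "AE x in lebesgue. f x = (\<lambda>_. 0) x"
  proof (rule density_unique_real[OF f])
    fix A :: "'a set" assume "A \<in> sets lebesgue"
    then obtain S N N' where A: "A = S \<union> N" "N \<subseteq> N'" "N' \<in> null_sets lborel" "S \<in> sets lborel"
      by (rule sets_completionE)
    have "AE x in lebesgue. x \<notin> N'"
      using A(3) by (intro AE_not_in null_sets_completionI)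
    then have "AE x in lebesgue. indicator A x *\<^sub>R f x = indicator S x *\<^sub>R f x"
      by eventually_elim (use A in \<open>auto simp: indicator_def\<close>)
    then have "(LINT x:A|lebesgue. f x) = (LINT x:S|lebesgue. f x)"
      unfolding set_lebesgue_integral_def
      using leb[OF \<open>A \<in> sets lebesgue\<close>] leb[OF sets_completionI_sets[OF A(4)]]
      by (intro integral_cong_AE) (simp_all only: set_integrable_def borel_measurable_integrable)
    then show "(LINT x:A|lebesgue. f x) = (LINT x:A|lebesgue. 0)"
      using borel A(4) by simp
  qed simp
  then show ?thesis by simp
qed

text \<open>
  Dominated convergence along the bumps of the box; the dominating function is \<open>\<bar>g\<bar>\<close> on the closed box,
  where \<open>g\<close> is integrable.
\<close>

lemma integral_box_zero_if_orthogonal: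
  fixes g :: "real ^ 'n \<Rightarrow> real"
  assumes g: "g locally_integrable_on \<Omega>"
    and orth: "\<And>\<phi>. \<phi> \<in> test_functions \<Omega> \<Longrightarrow> (LINT x:\<Omega>|lebesgue. g x * \<phi> x) = 0"
    and ab: "cbox a b \<subseteq> \<Omega>"
  shows "set_integrable lebesgue (box a b) g" "(LINT x:box a b|lebesgue. g x) = 0"
proof -
  have cbox: "set_integrable lebesgue (cbox a b) g"
    using g ab by (simp add: locally_integrable_on_def)
  then show box: "set_integrable lebesgue (box a b) g"
    by (rule set_integrable_subset) (auto simp: box_subset_cbox)
  have test: "box_bump a b m \<in> test_functions \<Omega>" for m
    using ab by (rule box_bump_test_function)
  have "(\<lambda>m. LINT x|lebesgue. indicator \<Omega> x *\<^sub>R (g x * box_bump a b m x))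
      \<longlonglongrightarrow> (LINT x|lebesgue. indicator (box a b) x *\<^sub>R g x)"
  proof (rule integral_dominated_convergence[where w = "\<lambda>x. norm (indicator (cbox a b) x *\<^sub>R g x)"])
    show "(\<lambda>x. indicator (box a b) x *\<^sub>R g x) \<in> borel_measurable lebesgue"
      using box unfolding set_integrable_def by (rule borel_measurable_integrable)
    show "(\<lambda>x. indicator \<Omega> x *\<^sub>R (g x * box_bump a b m x)) \<in> borel_measurable lebesgue" for m
      using set_integrable_mult_test_function[OF g test]
      unfolding set_integrable_def by (rule borel_measurable_integrable)
    show "integrable lebesgue (\<lambda>x. norm (indicator (cbox a b) x *\<^sub>R g x))"
      using cbox unfolding set_integrable_def by (rule integrable_norm)
    show "AE x in lebesgue. (\<lambda>m. indicator \<Omega> x *\<^sub>R (g x * box_bump a b m x))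
        \<longlonglongrightarrow> indicator (box a b) x *\<^sub>R g x"
    proof (rule AE_I2)
      fix x
      have "(\<lambda>m. indicator \<Omega> x *\<^sub>R (g x * box_bump a b m x))
          \<longlonglongrightarrow> indicator \<Omega> x *\<^sub>R (g x * indicator (box a b) x)"
        by (intro tendsto_intros tendsto_box_bump)
      moreover have "indicator \<Omega> x *\<^sub>R (g x * indicator (box a b) x) = indicator (box a b) x *\<^sub>R g x"
        using ab box_subset_cbox[of a b] by (auto simp: indicator_def)
      ultimately show "(\<lambda>m. indicator \<Omega> x *\<^sub>R (g x * box_bump a b m x))
          \<longlonglongrightarrow> indicator (box a b) x *\<^sub>R g x"
        by (simp only:)
    qed
    show "AE x in lebesgue. norm (indicator \<Omega> x *\<^sub>R (g x * box_bump a b m x))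
        \<le> norm (indicator (cbox a b) x *\<^sub>R g x)" for m
    proof (rule AE_I2)
      fix x
      show "norm (indicator \<Omega> x *\<^sub>R (g x * box_bump a b m x)) \<le> norm (indicator (cbox a b) x *\<^sub>R g x)"
      proof (cases "x \<in> box a b")
        case True
        then have "x \<in> cbox a b" "x \<in> \<Omega>"
          using box_subset_cbox[of a b] ab by auto
        moreover have "\<bar>g x\<bar> * box_bump a b m x \<le> \<bar>g x\<bar>"
          using box_bump_bounds[of a b m x] by (intro mult_left_le) auto
        ultimately show ?thesis
          using box_bump_bounds[of a b m x] by (simp add: abs_mult)
      qed (simp add: box_bump_outside)
    qed
  qed
  moreover have "(LINT x|lebesgue. indicator \<Omega> x *\<^sub>R (g x * box_bump a b m x)) = 0" for m
    using orth[OF test] by (simp add: set_lebesgue_integral_def)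
  ultimately show "(LINT x:box a b|lebesgue. g x) = 0"
    by (simp add: set_lebesgue_integral_def LIMSEQ_const_iff)
qed

text \<open>
  On a closed box inside \<open>\<Omega>\<close>, the function \<open>g\<close> restricted to the open box has integral zero over every
  box, since boxes intersect in boxes. Countably many closed boxes cover \<open>\<Omega>\<close>.
\<close>

lemma fundamental_lemma_calculus_of_variations:
  fixes g :: "real ^ 'n \<Rightarrow> real"
  assumes "open \<Omega>" and g: "g locally_integrable_on \<Omega>"
    and orth: "\<And>\<phi>. \<phi> \<in> test_functions \<Omega> \<Longrightarrow> (LINT x:\<Omega>|lebesgue. g x * \<phi> x) = 0"
  shows "AE x in lebesgue_on \<Omega>. g x = 0"
proof -
  have cbox: "AE x in lebesgue. x \<in> cbox c d \<longrightarrow> g x = 0" if cd: "cbox c d \<subseteq> \<Omega>" for c d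
  proof -
    have "AE x in lebesgue. indicator (box c d) x *\<^sub>R g x = 0"
    proof (rule AE_zero_if_integral_box_zero)
      show "integrable lebesgue (\<lambda>x. indicator (box c d) x *\<^sub>R g x)"
        using integral_box_zero_if_orthogonal(1)[OF g orth cd] by (simp add: set_integrable_def)
      show "(LINT x|lebesgue. indicator (box c d) x *\<^sub>R g x) = 0"
        using integral_box_zero_if_orthogonal(2)[OF g orth cd] by (simp add: set_lebesgue_integral_def)
      fix a b
      obtain e f where ef: "box a b \<inter> box c d = box e f" "cbox e f \<subseteq> cbox c d"
        by (rule box_Int_box_cbox)
      have "(LINT x:box a b|lebesgue. indicator (box c d) x *\<^sub>R g x) = (LINT x:box e f|lebesgue. g x)"
        unfolding ef(1)[symmetric] set_lebesgue_integral_def by (simp add: indicator_inter_arith mult.assoc)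
      also have "\<dots> = 0"
        using ef(2) cd by (intro integral_box_zero_if_orthogonal(2)[OF g orth]) auto
      finally show "(LINT x:box a b|lebesgue. indicator (box c d) x *\<^sub>R g x) = 0" .
    qed
    moreover have "AE x in lebesgue. x \<notin> cbox c d - box c d"
      using negligible_frontier_interval by (intro AE_not_in) (simp add: negligible_iff_null_sets)
    ultimately show ?thesis
      by eventually_elim (auto simp: indicator_def split: if_splits)
  qed
  obtain \<D> where \<D>: "countable \<D>" "\<D> \<subseteq> Pow \<Omega>" "\<And>X. X \<in> \<D> \<Longrightarrow> \<exists>a b. X = cbox a b" "\<Union>\<D> = \<Omega>"
    using open_countable_Union_open_cbox[OF \<open>open \<Omega>\<close>] by metis
  have "AE x in lebesgue. \<forall>X\<in>\<D>. x \<in> X \<longrightarrow> g x = 0"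
  proof (rule AE_ball_countable'[OF _ \<D>(1)])
    fix X assume "X \<in> \<D>"
    moreover from this obtain c d where "X = cbox c d"
      using \<D>(3) by blast
    ultimately show "AE x in lebesgue. x \<in> X \<longrightarrow> g x = 0"
      using cbox[of c d] \<D>(2) by auto
  qed
  then have "AE x in lebesgue. x \<in> \<Omega> \<longrightarrow> g x = 0"
    by eventually_elim (use \<D>(4) in blast)
  then show ?thesis
    using \<open>open \<Omega>\<close> by (simp add: AE_restrict_space_iff)
qed

lemma locally_integrable_on_linear:
  assumes "u locally_integrable_on \<Omega>" "v locally_integrable_on \<Omega>"
  shows "(\<lambda>x. c * u x + d * v x) locally_integrable_on \<Omega>"
  using assms unfolding locally_integrable_on_def
  by (auto intro!: set_integral_add set_integrable_mult_right)

lemma set_integral_linear_test_function: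
  assumes "u locally_integrable_on \<Omega>" "v locally_integrable_on \<Omega>" "\<phi> \<in> test_functions \<Omega>"
  shows "(LINT x:\<Omega>|lebesgue. (c * u x + d * v x) * \<phi> x) =
    c * (LINT x:\<Omega>|lebesgue. u x * \<phi> x) + d * (LINT x:\<Omega>|lebesgue. v x * \<phi> x)"
proof -
  have "(LINT x:\<Omega>|lebesgue. (c * u x + d * v x) * \<phi> x) =
      (LINT x:\<Omega>|lebesgue. c * (u x * \<phi> x) + d * (v x * \<phi> x))"
    by (simp add: algebra_simps)
  also have "\<dots> = c * (LINT x:\<Omega>|lebesgue. u x * \<phi> x) + d * (LINT x:\<Omega>|lebesgue. v x * \<phi> x)"
    using assms by (simp add: set_integral_add set_integrable_mult_test_function)
  finally show ?thesis .
qed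

lemma has_weak_partial_linear:
  assumes "has_weak_partial \<Omega> j u g" "has_weak_partial \<Omega> j v h"
  shows "has_weak_partial \<Omega> j (c *\<^sub>R u + d *\<^sub>R v) (\<lambda>x. c * g x + d * h x)"
proof -
  have "c *\<^sub>R u + d *\<^sub>R v = (\<lambda>x. c * u x + d * v x)"
    by (simp add: fun_eq_iff scaleR_fun_def)
  moreover note assms
  ultimately show ?thesis
    unfolding has_weak_partial_def
    by (auto simp: locally_integrable_on_linear set_integral_linear_test_function
        partial_deriv_test_function)
qed

lemma has_weak_partial_unique:
  fixes u :: "real ^ 'n \<Rightarrow> real"
  assumes "open \<Omega>" and g: "has_weak_partial \<Omega> j u g" and h: "has_weak_partial \<Omega> j u h"
  shows "AE x in lebesgue_on \<Omega>. g x = h x"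
proof -
  have loc: "g locally_integrable_on \<Omega>" "h locally_integrable_on \<Omega>"
    using g h by (auto simp: has_weak_partial_def)
  define w where "w = (\<lambda>x. 1 * g x + (- 1) * h x)"
  have "AE x in lebesgue_on \<Omega>. w x = 0"
  proof (rule fundamental_lemma_calculus_of_variations[OF \<open>open \<Omega>\<close>])
    show "w locally_integrable_on \<Omega>"
      unfolding w_def by (intro locally_integrable_on_linear loc)
    show "(LINT x:\<Omega>|lebesgue. w x * \<phi> x) = 0" if "\<phi> \<in> test_functions \<Omega>" for \<phi>
    proof -
      have "(LINT x:\<Omega>|lebesgue. w x * \<phi> x) =
          1 * (LINT x:\<Omega>|lebesgue. g x * \<phi> x) + (- 1) * (LINT x:\<Omega>|lebesgue. h x * \<phi> x)"
        unfolding w_def by (rule set_integral_linear_test_function[OF loc that])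
      moreover have "(LINT x:\<Omega>|lebesgue. u x * partial_deriv j \<phi> x) = - (LINT x:\<Omega>|lebesgue. g x * \<phi> x)"
        "(LINT x:\<Omega>|lebesgue. u x * partial_deriv j \<phi> x) = - (LINT x:\<Omega>|lebesgue. h x * \<phi> x)"
        using g h that unfolding has_weak_partial_def by blast+
      ultimately show ?thesis by simp
    qed
  qed
  then show ?thesis
    by (simp add: w_def)
qed

text \<open>
  Measurability holds on each of countably many closed boxes that cover \<open>\<Omega>\<close>.
\<close>

lemma locally_integrable_on_measurable:
  assumes "open \<Omega>" "u locally_integrable_on \<Omega>"
  shows "u \<in> borel_measurable (lebesgue_on \<Omega>)"
proof -
  obtain \<D> where \<D>: "countable \<D>" "\<D> \<subseteq> Pow \<Omega>" "\<And>X. X \<in> \<D> \<Longrightarrow> \<exists>a b. X = cbox a b" "\<Union>\<D> = \<Omega>"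
    using open_countable_Union_open_cbox[OF \<open>open \<Omega>\<close>] by metis
  show ?thesis
  proof (rule measurable_piecewise_restrict[OF \<D>(1)])
    fix X assume X: "X \<in> \<D>"
    then obtain a b where ab: "X = cbox a b" "X \<subseteq> \<Omega>"
      using \<D> by blast
    show "X \<inter> space (lebesgue_on \<Omega>) \<in> sets (lebesgue_on \<Omega>)"
      using ab assms(1) by (auto simp: sets_restrict_space_iff)
    have lebX: "X \<in> sets lebesgue"
      using ab(1) by simp
    have "u absolutely_integrable_on X"
      using assms(2) ab by (simp add: locally_integrable_on_def)
    then have "u \<in> borel_measurable (lebesgue_on X)"
      using absolutely_integrable_measurable[OF lebX] by blast
    moreover have "restrict_space (lebesgue_on \<Omega>) X = lebesgue_on X"
      using ab(2) lebX assms(1) by (subst restrict_restrict_space) (auto simp: Int_absorb1)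
    ultimately show "u \<in> borel_measurable (restrict_space (lebesgue_on \<Omega>) X)"
      by simp
  qed (use \<D>(4) in auto)
qed

text \<open>
  This linear space is the common domain of the modulars; the Sobolev space is cut out of it by a
  finiteness condition.
\<close>

definition weakly_differentiable :: "(real ^ 'n) set \<Rightarrow> (real ^ 'n \<Rightarrow> real) set" where
  "weakly_differentiable \<Omega> = {u. u \<in> borel_measurable (restrict_space borel \<Omega>) \<and>
     (\<forall>j. \<exists>g. has_weak_partial \<Omega> j u g)}"

lemma has_weak_partial_weak_partial:
  "u \<in> weakly_differentiable \<Omega> \<Longrightarrow> has_weak_partial \<Omega> j u (weak_partial \<Omega> j u)"
  unfolding weakly_differentiable_def weak_partial_def by (auto intro: someI_ex[of "has_weak_partial \<Omega> j u"])

lemma weakly_differentiable_linear: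
  assumes u: "u \<in> weakly_differentiable \<Omega>" and v: "v \<in> weakly_differentiable \<Omega>"
  shows "c *\<^sub>R u + d *\<^sub>R v \<in> weakly_differentiable \<Omega>"
proof -
  have "c *\<^sub>R u + d *\<^sub>R v = (\<lambda>x. c * u x + d * v x)"
    by (simp add: fun_eq_iff scaleR_fun_def)
  moreover have "u \<in> borel_measurable (restrict_space borel \<Omega>)"
    "v \<in> borel_measurable (restrict_space borel \<Omega>)"
    using assms by (auto simp: weakly_differentiable_def)
  ultimately have "c *\<^sub>R u + d *\<^sub>R v \<in> borel_measurable (restrict_space borel \<Omega>)"
    by (simp only:) (intro borel_measurable_add borel_measurable_times borel_measurable_const)
  then show ?thesis
    using has_weak_partial_linear[OF has_weak_partial_weak_partial[OF u] has_weak_partial_weak_partial[OF v]]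
    by (auto simp: weakly_differentiable_def)
qed

lemma subspace_weakly_differentiable: "subspace (weakly_differentiable \<Omega>)"
proof (rule subspaceI)
  have "has_weak_partial \<Omega> j 0 (\<lambda>_. 0)" for j
    by (auto simp: has_weak_partial_def locally_integrable_on_def set_integrable_def
        set_lebesgue_integral_def)
  moreover have "(0 :: real ^ 'a \<Rightarrow> real) \<in> borel_measurable (restrict_space borel \<Omega>)"
    unfolding zero_fun_def by simp
  ultimately show "0 \<in> weakly_differentiable \<Omega>"
    by (auto simp: weakly_differentiable_def)
  show "u + v \<in> weakly_differentiable \<Omega>"
    if "u \<in> weakly_differentiable \<Omega>" "v \<in> weakly_differentiable \<Omega>" for u v
    using weakly_differentiable_linear[OF that, of 1 1] by simp
  show "c *\<^sub>R u \<in> weakly_differentiable \<Omega>" if "u \<in> weakly_differentiable \<Omega>" for c u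
    using weakly_differentiable_linear[OF that that, of c 0] by simp
qed

text \<open>
  The chosen weak derivative of a combination and the combination of the chosen weak derivatives are
  both weak derivatives of the same function.
\<close>

lemma weak_gradient_linear:
  assumes "open \<Omega>" and u: "u \<in> weakly_differentiable \<Omega>" and v: "v \<in> weakly_differentiable \<Omega>"
  shows "AE x in lebesgue_on \<Omega>.
    weak_gradient \<Omega> (c *\<^sub>R u + d *\<^sub>R v) x = c *\<^sub>R weak_gradient \<Omega> u x + d *\<^sub>R weak_gradient \<Omega> v x"
proof -
  have "AE x in lebesgue_on \<Omega>. \<forall>j\<in>UNIV. weak_partial \<Omega> j (c *\<^sub>R u + d *\<^sub>R v) x =
      c * weak_partial \<Omega> j u x + d * weak_partial \<Omega> j v x"
  proof (rule AE_finite_allI[OF finite])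
    fix j
    show "AE x in lebesgue_on \<Omega>. weak_partial \<Omega> j (c *\<^sub>R u + d *\<^sub>R v) x =
        c * weak_partial \<Omega> j u x + d * weak_partial \<Omega> j v x"
      by (rule has_weak_partial_unique[OF \<open>open \<Omega>\<close>
            has_weak_partial_weak_partial[OF weakly_differentiable_linear[OF u v]]
            has_weak_partial_linear[OF has_weak_partial_weak_partial[OF u]
              has_weak_partial_weak_partial[OF v]]])
  qed
  then show ?thesis
    by eventually_elim (simp add: weak_gradient_def vec_eq_iff)
qed

lemma weakly_differentiable_measurable:
  assumes "open \<Omega>" "u \<in> weakly_differentiable \<Omega>"
  shows "u \<in> borel_measurable (lebesgue_on \<Omega>)"
    "weak_gradient \<Omega> u \<in> borel_measurable (lebesgue_on \<Omega>)"
proof -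
  have loc: "u locally_integrable_on \<Omega>" "weak_partial \<Omega> j u locally_integrable_on \<Omega>" for j
    using has_weak_partial_weak_partial[OF assms(2)] by (auto simp: has_weak_partial_def)
  show "u \<in> borel_measurable (lebesgue_on \<Omega>)"
    by (rule locally_integrable_on_measurable[OF assms(1) loc(1)])
  have "(\<lambda>x. weak_gradient \<Omega> u x \<bullet> i) \<in> borel_measurable (lebesgue_on \<Omega>)" if "i \<in> Basis" for i
    using that locally_integrable_on_measurable[OF assms(1) loc(2)]
    by (auto simp: Basis_vec_def inner_axis weak_gradient_def)
  then show "weak_gradient \<Omega> u \<in> borel_measurable (lebesgue_on \<Omega>)"
    using borel_measurable_euclidean_space by blast
qed


section \<open>Pseudomodulars and their modular spaces\<close>

lemma convex_pseudomodular_on_subset: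
  assumes "convex_pseudomodular_on V \<rho>" "subspace U" "U \<subseteq> V"
  shows "convex_pseudomodular_on U \<rho>"
  using assms unfolding convex_pseudomodular_on_def by blast

lemma convex_pseudomodular_on_add:
  assumes "convex_pseudomodular_on V \<rho>" "convex_pseudomodular_on V \<sigma>"
  shows "convex_pseudomodular_on V (\<lambda>u. \<rho> u + \<sigma> u)"
proof -
  have "\<rho> (\<alpha> *\<^sub>R u + (1 - \<alpha>) *\<^sub>R v) + \<sigma> (\<alpha> *\<^sub>R u + (1 - \<alpha>) *\<^sub>R v)
      \<le> ennreal \<alpha> * (\<rho> u + \<sigma> u) + ennreal (1 - \<alpha>) * (\<rho> v + \<sigma> v)"
    if "u \<in> V" "v \<in> V" "\<alpha> \<in> {0..1}" for u v \<alpha>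
  proof -
    have "\<rho> (\<alpha> *\<^sub>R u + (1 - \<alpha>) *\<^sub>R v) + \<sigma> (\<alpha> *\<^sub>R u + (1 - \<alpha>) *\<^sub>R v)
      \<le> (ennreal \<alpha> * \<rho> u + ennreal (1 - \<alpha>) * \<rho> v) + (ennreal \<alpha> * \<sigma> u + ennreal (1 - \<alpha>) * \<sigma> v)"
      using assms that unfolding convex_pseudomodular_on_def by (intro add_mono) blast+
    then show ?thesis
      by (simp add: distrib_left ac_simps)
  qed
  then show ?thesis
    using assms by (simp add: convex_pseudomodular_on_def)
qed

lemma UC_star_on_subset:
  assumes UC: "UC_star_on V \<rho>" and "U \<subseteq> V"
  shows "UC_star_on U \<rho>"
  unfolding UC_star_on_def
proof (intro allI impI)
  fix \<epsilon> :: real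
  assume "0 < \<epsilon>"
  from UC[unfolded UC_star_on_def, THEN spec, THEN mp, OF this]
  obtain \<delta> where \<delta>: "0 < \<delta>" "\<forall>u\<in>V. \<forall>v\<in>V.
      ennreal \<epsilon> * ((\<rho> u + \<rho> v) / 2) \<le> \<rho> ((1/2) *\<^sub>R (u - v)) \<longrightarrow>
      \<rho> ((1/2) *\<^sub>R (u + v)) \<le> ennreal (1 - \<delta>) * ((\<rho> u + \<rho> v) / 2)"
    by (elim exE conjE) (rule that)
  then show "\<exists>\<delta>>0. \<forall>u\<in>U. \<forall>v\<in>U.
      ennreal \<epsilon> * ((\<rho> u + \<rho> v) / 2) \<le> \<rho> ((1/2) *\<^sub>R (u - v)) \<longrightarrow>
      \<rho> ((1/2) *\<^sub>R (u + v)) \<le> ennreal (1 - \<delta>) * ((\<rho> u + \<rho> v) / 2)"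
    using \<open>U \<subseteq> V\<close> by (intro exI[of _ \<delta>]) (simp add: subset_iff)
qed

text \<open>
  By convexity \<open>\<rho>\<close> is finite along the segment from the origin to any point where it is finite, and at
  the midpoint of two such points. A common scaling factor for \<open>u\<close> and \<open>v\<close>, halved, therefore works
  for \<open>u + v\<close>.
\<close>

lemma subspace_modular_space:
  assumes \<rho>: "convex_pseudomodular_on V \<rho>" and zero: "\<rho> 0 < \<infinity>"
  shows "subspace {u \<in> V. \<exists>c>0. \<rho> (c *\<^sub>R u) < \<infinity>}" (is "subspace ?W")
proof -
  have V: "subspace V"
    and abs: "\<And>u \<alpha>. u \<in> V \<Longrightarrow> \<bar>\<alpha>\<bar> = 1 \<Longrightarrow> \<rho> (\<alpha> *\<^sub>R u) = \<rho> u"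
    and convex: "\<And>u v \<alpha>. u \<in> V \<Longrightarrow> v \<in> V \<Longrightarrow> \<alpha> \<in> {0..1} \<Longrightarrow>
      \<rho> (\<alpha> *\<^sub>R u + (1 - \<alpha>) *\<^sub>R v) \<le> ennreal \<alpha> * \<rho> u + ennreal (1 - \<alpha>) * \<rho> v"
    using \<rho> by (auto simp: convex_pseudomodular_on_def)
  have finite_convex: "\<rho> (\<alpha> *\<^sub>R u + (1 - \<alpha>) *\<^sub>R v) < \<infinity>"
    if "u \<in> V" "v \<in> V" "\<alpha> \<in> {0..1}" "\<rho> u < \<infinity>" "\<rho> v < \<infinity>" for u v \<alpha>
    using convex[OF that(1-3)] that(4,5)
    by (elim le_less_trans) (simp add: ennreal_mult_less_top)
  have shrink: "\<rho> (t *\<^sub>R u) < \<infinity>" if "u \<in> V" "0 \<le> t" "t \<le> c" "0 < c" "\<rho> (c *\<^sub>R u) < \<infinity>" for u t c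
  proof -
    have "\<rho> ((t / c) *\<^sub>R (c *\<^sub>R u) + (1 - t / c) *\<^sub>R 0) < \<infinity>"
      using that zero V by (intro finite_convex) (auto simp: subspace_scale subspace_0)
    then show ?thesis
      using that by simp
  qed
  show ?thesis
  proof (rule subspaceI)
    show "0 \<in> ?W"
      using zero V by (auto simp: subspace_0 intro: exI[of _ 1])
  next
    fix u v assume "u \<in> ?W" "v \<in> ?W"
    then obtain c d where u: "u \<in> V" "0 < c" "\<rho> (c *\<^sub>R u) < \<infinity>"
      and v: "v \<in> V" "0 < d" "\<rho> (d *\<^sub>R v) < \<infinity>"
      by blast
    define e where "e = min c d"
    have e: "0 < e" "e \<le> c" "e \<le> d"
      using u v by (auto simp: e_def)
    have "\<rho> (e *\<^sub>R u) < \<infinity>"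
      using e by (intro shrink[OF u(1) _ e(2) u(2,3)]) simp
    moreover have "\<rho> (e *\<^sub>R v) < \<infinity>"
      using e by (intro shrink[OF v(1) _ e(3) v(2,3)]) simp
    ultimately have "\<rho> ((1/2) *\<^sub>R (e *\<^sub>R u) + (1 - 1/2) *\<^sub>R (e *\<^sub>R v)) < \<infinity>"
      by (intro finite_convex subspace_scale[OF V] u(1) v(1)) auto
    then have "\<rho> ((e / 2) *\<^sub>R (u + v)) < \<infinity>"
      by (simp add: scaleR_add_right)
    then show "u + v \<in> ?W"
      using u v V e by (auto simp: subspace_add intro!: exI[of _ "e / 2"])
  next
    fix s u assume "u \<in> ?W"
    then obtain c where u: "u \<in> V" "0 < c" "\<rho> (c *\<^sub>R u) < \<infinity>"
      by blast
    show "s *\<^sub>R u \<in> ?W"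
    proof (cases "s = 0")
      case True
      then show ?thesis
        using zero V by (auto simp: subspace_0 intro: exI[of _ 1])
    next
      case False
      have "(c / \<bar>s\<bar>) *\<^sub>R (s *\<^sub>R u) = sgn s *\<^sub>R (c *\<^sub>R u)"
        using False by (auto simp: sgn_if)
      then have "\<rho> ((c / \<bar>s\<bar>) *\<^sub>R (s *\<^sub>R u)) = \<rho> (c *\<^sub>R u)"
        using abs[OF subspace_scale[OF V u(1)], of "sgn s" c] False by (simp only: abs_sgn_eq) simp
      then show ?thesis
        using u V False by (auto simp: subspace_scale intro!: exI[of _ "c / \<bar>s\<bar>"])
    qed
  qed
qed


section \<open>The gradient modular\<close>

lemma measurable_norm_powr_div:
  fixes F :: "real ^ 'n \<Rightarrow> 'b::euclidean_space"
  assumes "p \<in> borel_measurable (lebesgue_on \<Omega>)" "F \<in> borel_measurable (lebesgue_on \<Omega>)"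
  shows "(\<lambda>x. ennreal (norm (F x) powr p x / p x)) \<in> borel_measurable (lebesgue_on \<Omega>)"
  using assms by measurable

lemma rho_p_norm: "rho_p \<Omega> p (\<lambda>x. norm (F x)) =
    (\<integral>\<^sup>+ x. ennreal (norm (F x) powr p x / p x) \<partial>lebesgue_on \<Omega>)"
  by (simp add: rho_p_def)

lemma rho_p_norm_cong_AE:
  assumes "AE x in lebesgue_on \<Omega>. norm (F x) = norm (G x)"
  shows "rho_p \<Omega> p (\<lambda>x. norm (F x)) = rho_p \<Omega> p (\<lambda>x. norm (G x))"
  unfolding rho_p_norm by (rule nn_integral_cong_AE) (use assms in eventually_elim, simp)

text \<open>
  Stated for vector fields, so that it serves both for functions and for their gradients.
\<close>

lemma rho_p_norm_convex:
  fixes F G :: "real ^ 'n \<Rightarrow> 'b::euclidean_space"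
  assumes p: "p \<in> borel_measurable (lebesgue_on \<Omega>)" "\<And>x. x \<in> \<Omega> \<Longrightarrow> 1 \<le> p x"
    and F: "F \<in> borel_measurable (lebesgue_on \<Omega>)" and G: "G \<in> borel_measurable (lebesgue_on \<Omega>)"
    and \<alpha>: "0 \<le> \<alpha>" "\<alpha> \<le> 1"
  shows "rho_p \<Omega> p (\<lambda>x. norm (\<alpha> *\<^sub>R F x + (1 - \<alpha>) *\<^sub>R G x)) \<le>
    ennreal \<alpha> * rho_p \<Omega> p (\<lambda>x. norm (F x)) + ennreal (1 - \<alpha>) * rho_p \<Omega> p (\<lambda>x. norm (G x))"
proof -
  note meas = measurable_norm_powr_div[OF p(1) F] measurable_norm_powr_div[OF p(1) G]
  have "rho_p \<Omega> p (\<lambda>x. norm (\<alpha> *\<^sub>R F x + (1 - \<alpha>) *\<^sub>R G x)) \<le>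
    (\<integral>\<^sup>+ x. ennreal \<alpha> * ennreal (norm (F x) powr p x / p x) +
      ennreal (1 - \<alpha>) * ennreal (norm (G x) powr p x / p x) \<partial>lebesgue_on \<Omega>)"
    unfolding rho_p_norm
  proof (rule nn_integral_mono)
    fix x assume "x \<in> space (lebesgue_on \<Omega>)"
    then have px: "1 \<le> p x"
      using p(2) by simp
    have "norm (\<alpha> *\<^sub>R F x + (1 - \<alpha>) *\<^sub>R G x) powr p x / p x \<le>
        (\<alpha> * norm (F x) powr p x + (1 - \<alpha>) * norm (G x) powr p x) / p x"
      using norm_powr_convex[OF px \<alpha>] px by (intro divide_right_mono) auto
    then show "ennreal (norm (\<alpha> *\<^sub>R F x + (1 - \<alpha>) *\<^sub>R G x) powr p x / p x) \<le>
        ennreal \<alpha> * ennreal (norm (F x) powr p x / p x) +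
        ennreal (1 - \<alpha>) * ennreal (norm (G x) powr p x / p x)"
      using px \<alpha> by (simp add: add_divide_distrib flip: ennreal_mult ennreal_plus)
  qed
  also have "\<dots> = ennreal \<alpha> * rho_p \<Omega> p (\<lambda>x. norm (F x)) +
      ennreal (1 - \<alpha>) * rho_p \<Omega> p (\<lambda>x. norm (G x))"
    unfolding rho_p_norm using meas
    by (simp add: nn_integral_add nn_integral_cmult borel_measurable_times)
  finally show ?thesis .
qed

text \<open>
  A pointwise bound with constants independent of \<open>x\<close> can be divided by \<open>p(x)\<close> and integrated.
\<close>

lemma rho_p_norm_midpoint_bound:
  fixes F G :: "real ^ 'n \<Rightarrow> 'b::euclidean_space" and \<delta> \<kappa> :: real
  assumes p: "p \<in> borel_measurable (lebesgue_on \<Omega>)" "\<And>x. x \<in> \<Omega> \<Longrightarrow> 0 < p x"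
    and FG: "F \<in> borel_measurable (lebesgue_on \<Omega>)" "G \<in> borel_measurable (lebesgue_on \<Omega>)"
    and \<delta>: "0 \<le> \<delta>" and \<kappa>: "0 \<le> \<kappa>"
    and pointwise: "\<And>x (a::'b) b. x \<in> \<Omega> \<Longrightarrow>
      norm ((1/2) *\<^sub>R (a + b)) powr p x + \<delta> * norm ((1/2) *\<^sub>R (a - b)) powr p x
        \<le> \<kappa> * ((norm a powr p x + norm b powr p x) / 2)"
  shows "rho_p \<Omega> p (\<lambda>x. norm ((1/2) *\<^sub>R (F x + G x)))
      + ennreal \<delta> * rho_p \<Omega> p (\<lambda>x. norm ((1/2) *\<^sub>R (F x - G x)))
    \<le> ennreal \<kappa> * ((rho_p \<Omega> p (\<lambda>x. norm (F x)) + rho_p \<Omega> p (\<lambda>x. norm (G x))) / 2)"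
proof -
  define S where "S = (\<lambda>x. (1/2) *\<^sub>R (F x + G x))"
  define D where "D = (\<lambda>x. (1/2) *\<^sub>R (F x - G x))"
  have SD: "S \<in> borel_measurable (lebesgue_on \<Omega>)" "D \<in> borel_measurable (lebesgue_on \<Omega>)"
    unfolding S_def D_def using FG by measurable
  note meas = measurable_norm_powr_div[OF p(1) FG(1)] measurable_norm_powr_div[OF p(1) FG(2)]
    measurable_norm_powr_div[OF p(1) SD(1)] measurable_norm_powr_div[OF p(1) SD(2)]
  define C where "C = \<kappa> / 2"
  have C: "0 \<le> C"
    using \<kappa> by (simp add: C_def)
  have "rho_p \<Omega> p (\<lambda>x. norm (S x)) + ennreal \<delta> * rho_p \<Omega> p (\<lambda>x. norm (D x)) =
    (\<integral>\<^sup>+ x. ennreal (norm (S x) powr p x / p x)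
       + ennreal \<delta> * ennreal (norm (D x) powr p x / p x) \<partial>lebesgue_on \<Omega>)"
    unfolding rho_p_norm using meas
    by (simp add: nn_integral_add nn_integral_cmult borel_measurable_times)
  also have "\<dots> \<le> (\<integral>\<^sup>+ x. ennreal C * (ennreal (norm (F x) powr p x / p x)
       + ennreal (norm (G x) powr p x / p x)) \<partial>lebesgue_on \<Omega>)"
  proof (rule nn_integral_mono)
    fix x assume "x \<in> space (lebesgue_on \<Omega>)"
    then have x: "x \<in> \<Omega>" and px: "0 < p x"
      using p(2) by auto
    have "(norm (S x) powr p x + \<delta> * norm (D x) powr p x) / p x \<le>
        (\<kappa> * ((norm (F x) powr p x + norm (G x) powr p x) / 2)) / p x"
      using pointwise[OF x] px by (intro divide_right_mono) (auto simp: S_def D_def)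
    also have "\<dots> = C * (norm (F x) powr p x / p x + norm (G x) powr p x / p x)"
      unfolding C_def add_divide_distrib[symmetric] by (simp only: times_divide_eq_left times_divide_eq_right)
    finally have "norm (S x) powr p x / p x + \<delta> * (norm (D x) powr p x / p x) \<le>
        C * (norm (F x) powr p x / p x + norm (G x) powr p x / p x)"
      by (simp only: add_divide_distrib times_divide_eq_right)
    then show "ennreal (norm (S x) powr p x / p x) + ennreal \<delta> * ennreal (norm (D x) powr p x / p x)
        \<le> ennreal C * (ennreal (norm (F x) powr p x / p x) + ennreal (norm (G x) powr p x / p x))"
      using px \<delta> C by (simp flip: ennreal_mult ennreal_plus)
  qed
  also have "\<dots> = ennreal C * (rho_p \<Omega> p (\<lambda>x. norm (F x)) + rho_p \<Omega> p (\<lambda>x. norm (G x)))"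
    unfolding rho_p_norm using meas by (simp add: nn_integral_add nn_integral_cmult)
  also have "ennreal C = ennreal \<kappa> / ennreal 2"
    unfolding C_def using \<kappa> by (intro divide_ennreal[symmetric]) auto
  finally show "rho_p \<Omega> p (\<lambda>x. norm ((1/2) *\<^sub>R (F x + G x)))
      + ennreal \<delta> * rho_p \<Omega> p (\<lambda>x. norm ((1/2) *\<^sub>R (F x - G x)))
    \<le> ennreal \<kappa> * ((rho_p \<Omega> p (\<lambda>x. norm (F x)) + rho_p \<Omega> p (\<lambda>x. norm (G x))) / 2)"
    by (simp add: S_def D_def divide_ennreal_def mult.assoc mult.commute[of "inverse 2"])
qed

lemma convex_pseudomodular_rho_p:
  assumes "open \<Omega>" and p: "p \<in> borel_measurable (lebesgue_on \<Omega>)" "\<And>x. x \<in> \<Omega> \<Longrightarrow> 1 \<le> p x"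
  shows "convex_pseudomodular_on (weakly_differentiable \<Omega>) (rho_p \<Omega> p)"
  unfolding convex_pseudomodular_on_def
proof (intro conjI ballI allI impI subspace_weakly_differentiable)
  have rho: "rho_p \<Omega> p w = rho_p \<Omega> p (\<lambda>x. norm (w x))" for w
    by (simp add: rho_p_def)
  show "rho_p \<Omega> p (\<alpha> *\<^sub>R u) = rho_p \<Omega> p u" if "\<bar>\<alpha>\<bar> = 1" for \<alpha> u
    using that by (simp add: rho_p_def scaleR_fun_def abs_mult)
  fix u v \<alpha> assume "u \<in> weakly_differentiable \<Omega>" "v \<in> weakly_differentiable \<Omega>" "\<alpha> \<in> {0..1::real}"
  then show "rho_p \<Omega> p (\<alpha> *\<^sub>R u + (1 - \<alpha>) *\<^sub>R v) \<le>
      ennreal \<alpha> * rho_p \<Omega> p u + ennreal (1 - \<alpha>) * rho_p \<Omega> p v"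
    using rho_p_norm_convex[OF p, of u v \<alpha>] weakly_differentiable_measurable(1)[OF assms(1)]
    by (simp add: rho[of "\<lambda>x. \<alpha> * u x + (1 - \<alpha>) * v x"] rho[of u] rho[of v]
        scaleR_fun_def plus_fun_def)
qed

lemma grad_modular_linear:
  assumes "open \<Omega>" "u \<in> weakly_differentiable \<Omega>" "v \<in> weakly_differentiable \<Omega>"
  shows "grad_modular \<Omega> p (c *\<^sub>R u + d *\<^sub>R v) =
    rho_p \<Omega> p (\<lambda>x. norm (c *\<^sub>R weak_gradient \<Omega> u x + d *\<^sub>R weak_gradient \<Omega> v x))"
  unfolding grad_modular_def
  by (rule rho_p_norm_cong_AE) (use weak_gradient_linear[OF assms, of c d] in eventually_elim, simp)

lemma grad_modular_scale:
  assumes "open \<Omega>" "u \<in> weakly_differentiable \<Omega>"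
  shows "grad_modular \<Omega> p (c *\<^sub>R u) = rho_p \<Omega> p (\<lambda>x. norm (c *\<^sub>R weak_gradient \<Omega> u x))"
  using grad_modular_linear[OF assms assms(2), of p c 0] by simp

lemma convex_pseudomodular_grad_modular:
  assumes "open \<Omega>" and p: "p \<in> borel_measurable (lebesgue_on \<Omega>)" "\<And>x. x \<in> \<Omega> \<Longrightarrow> 1 \<le> p x"
  shows "convex_pseudomodular_on (weakly_differentiable \<Omega>) (grad_modular \<Omega> p)"
  unfolding convex_pseudomodular_on_def
proof (intro conjI ballI allI impI subspace_weakly_differentiable)
  show "grad_modular \<Omega> p (\<alpha> *\<^sub>R u) = grad_modular \<Omega> p u"
    if "u \<in> weakly_differentiable \<Omega>" "\<bar>\<alpha>\<bar> = 1" for \<alpha> u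
    using that by (simp add: grad_modular_scale[OF assms(1)]) (simp add: grad_modular_def)
  fix u v \<alpha> assume "u \<in> weakly_differentiable \<Omega>" "v \<in> weakly_differentiable \<Omega>" "\<alpha> \<in> {0..1::real}"
  then show "grad_modular \<Omega> p (\<alpha> *\<^sub>R u + (1 - \<alpha>) *\<^sub>R v) \<le>
      ennreal \<alpha> * grad_modular \<Omega> p u + ennreal (1 - \<alpha>) * grad_modular \<Omega> p v"
    using rho_p_norm_convex[OF p, of "weak_gradient \<Omega> u" "weak_gradient \<Omega> v" \<alpha>]
      weakly_differentiable_measurable(2)[OF assms(1)]
    by (simp add: grad_modular_linear[OF assms(1)]) (simp add: grad_modular_def)
qed

text \<open>
  The full modular \<open>\<rho>\<^bsub>1,p\<^esub>\<close> is the sum of two convex pseudomodulars, and the Sobolev space is its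
  modular space.
\<close>

lemma subspace_W1p:
  assumes "open \<Omega>" and p: "p \<in> borel_measurable (lebesgue_on \<Omega>)" "\<And>x. x \<in> \<Omega> \<Longrightarrow> 1 \<le> p x"
  shows "subspace (W1p \<Omega> p)"
proof -
  have rho_1p: "rho_1p \<Omega> p = (\<lambda>u. rho_p \<Omega> p u + grad_modular \<Omega> p u)"
    by (simp add: fun_eq_iff rho_1p_def grad_modular_def)
  have conv: "convex_pseudomodular_on (weakly_differentiable \<Omega>) (rho_1p \<Omega> p)"
    unfolding rho_1p using assms
    by (intro convex_pseudomodular_on_add convex_pseudomodular_rho_p convex_pseudomodular_grad_modular)
  have zero: "rho_1p \<Omega> p 0 < \<infinity>"
  proof -
    have "0 \<in> weakly_differentiable \<Omega>"
      by (rule subspace_0[OF subspace_weakly_differentiable])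
    then have "grad_modular \<Omega> p 0 = 0"
      using grad_modular_scale[OF assms(1), of 0 p 0] by (simp add: rho_p_def)
    then show ?thesis
      by (simp add: rho_1p rho_p_def)
  qed
  have "subspace {u \<in> weakly_differentiable \<Omega>. \<exists>c>0. rho_1p \<Omega> p (c *\<^sub>R u) < \<infinity>}"
    by (rule subspace_modular_space[where \<rho> = "rho_1p \<Omega> p", OF conv zero])
  moreover have "W1p \<Omega> p = {u \<in> weakly_differentiable \<Omega>. \<exists>c>0. rho_1p \<Omega> p (c *\<^sub>R u) < \<infinity>}"
    by (auto simp: W1p_def weakly_differentiable_def)
  ultimately show ?thesis by simp
qed

text \<open>
  The integrated inequality is used with \<open>\<epsilon>'/2\<close> in place of \<open>\<epsilon>\<close>: of the gain \<open>\<delta>\<epsilon>' M\<close> that the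
  hypothesis yields, one half is spent on the error term, and \<open>\<eta> = \<delta>\<epsilon>'/2\<close> remains.
\<close>

lemma UC_star_grad_modular:
  fixes \<Omega> :: "(real ^ 'n) set"
  assumes "open \<Omega>" and p: "p \<in> borel_measurable (lebesgue_on \<Omega>)" "\<And>x. x \<in> \<Omega> \<Longrightarrow> q \<le> p x" and "1 < q"
  shows "UC_star_on (weakly_differentiable \<Omega>) (grad_modular \<Omega> p)"
  unfolding UC_star_on_def
proof (intro allI impI)
  fix \<epsilon> :: real
  assume "0 < \<epsilon>"
  \<comment> \<open>The pointwise inequality needs a parameter of at most 1, and the hypothesis for \<open>\<epsilon>\<close> implies that for \<open>\<epsilon>'\<close>.\<close>
  define \<epsilon>' where "\<epsilon>' = min \<epsilon> 1"
  have \<epsilon>': "0 < \<epsilon>' / 2" "\<epsilon>' / 2 \<le> 1" "\<epsilon>' \<le> \<epsilon>"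
    using \<open>0 < \<epsilon>\<close> by (auto simp: \<epsilon>'_def)
  obtain \<delta> where \<delta>: "0 < \<delta>" "\<delta> < 1"
    and pointwise: "\<And>(a::real ^ 'n) b p. q \<le> p \<Longrightarrow>
      norm ((1/2) *\<^sub>R (a + b)) powr p + \<delta> * norm ((1/2) *\<^sub>R (a - b)) powr p
        \<le> (1 + \<delta> * (\<epsilon>' / 2)) * ((norm a powr p + norm b powr p) / 2)"
    using norm_powr_uniformly_convex[OF \<open>1 < q\<close> \<epsilon>'(1,2), where 'a = "real ^ 'n"] by metis
  define \<eta> where "\<eta> = \<delta> * (\<epsilon>' / 2)"
  have "\<eta> < 1 * 1"
    unfolding \<eta>_def using \<delta> \<epsilon>' by (intro mult_less_le_imp_less) auto
  then have \<eta>: "0 < \<eta>" "\<eta> < 1"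
    using \<delta> \<epsilon>' by (auto simp: \<eta>_def)
  have "grad_modular \<Omega> p ((1/2) *\<^sub>R (u + v)) \<le> ennreal (1 - \<eta>) * ((grad_modular \<Omega> p u + grad_modular \<Omega> p v) / 2)"
    if uv: "u \<in> weakly_differentiable \<Omega>" "v \<in> weakly_differentiable \<Omega>"
      and large: "ennreal \<epsilon> * ((grad_modular \<Omega> p u + grad_modular \<Omega> p v) / 2)
        \<le> grad_modular \<Omega> p ((1/2) *\<^sub>R (u - v))" for u v
  proof -
    define M where "M = (grad_modular \<Omega> p u + grad_modular \<Omega> p v) / 2"
    define S where "S = grad_modular \<Omega> p ((1/2) *\<^sub>R (u + v))"
    define D where "D = grad_modular \<Omega> p ((1/2) *\<^sub>R (u - v))"
    have S: "S = rho_p \<Omega> p (\<lambda>x. norm ((1/2) *\<^sub>R (weak_gradient \<Omega> u x + weak_gradient \<Omega> v x)))"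
      using grad_modular_linear[OF assms(1) uv, of p "1/2" "1/2"]
      by (simp add: S_def scaleR_add_right)
    have D: "D = rho_p \<Omega> p (\<lambda>x. norm ((1/2) *\<^sub>R (weak_gradient \<Omega> u x - weak_gradient \<Omega> v x)))"
      using grad_modular_linear[OF assms(1) uv, of p "1/2" "- (1/2)"]
      by (simp add: D_def scaleR_diff_right)
    have bound: "S + ennreal \<delta> * D \<le> ennreal (1 + \<eta>) * M"
      unfolding S D M_def grad_modular_def \<eta>_def
    proof (rule rho_p_norm_midpoint_bound[OF p(1)])
      show "0 < p x" if "x \<in> \<Omega>" for x
        using p(2)[OF that] \<open>1 < q\<close> by simp
    qed (use weakly_differentiable_measurable(2)[OF assms(1)] uv \<delta> \<epsilon>' pointwise p(2) in auto)
    show ?thesis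
    proof (cases "M = \<infinity>")
      case True
      then have "ennreal (1 - \<eta>) * M = \<infinity>"
        using \<eta> by (simp add: ennreal_mult_eq_top_iff)
      then show ?thesis
        by (simp add: M_def)
    next
      case False
      then obtain m where m: "M = ennreal m" "0 \<le> m"
        by (cases M) auto
      have "ennreal \<epsilon>' * M \<le> ennreal \<epsilon> * M"
        using \<epsilon>' by (intro mult_right_mono ennreal_leI) auto
      also have "\<dots> \<le> D"
        using large by (simp add: M_def D_def)
      finally have "ennreal \<delta> * (ennreal \<epsilon>' * M) \<le> ennreal \<delta> * D"
        by (rule mult_left_mono) simp
      moreover have "ennreal \<delta> * (ennreal \<epsilon>' * M) = ennreal (2 * \<eta> * m)"
        using \<delta> \<epsilon>' m by (simp add: \<eta>_def mult.assoc flip: ennreal_mult)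
      ultimately have "S + ennreal (2 * \<eta> * m) \<le> ennreal (1 + \<eta>) * M"
        using order_trans[OF add_left_mono bound] by simp
      then have sum: "S + ennreal (2 * \<eta> * m) \<le> ennreal ((1 + \<eta>) * m)"
        using \<eta> m by (simp add: ennreal_mult)
      \<comment> \<open>All terms are finite here, so the last one can be subtracted in the reals.\<close>
      then have "S \<noteq> \<infinity>"
        by (auto simp: top_unique)
      then obtain s where s: "S = ennreal s" "0 \<le> s"
        by (cases S) auto
      have "s + 2 * \<eta> * m \<le> (1 + \<eta>) * m"
        using sum s \<eta> m by (simp flip: ennreal_plus)
      then have "s \<le> (1 - \<eta>) * m"
        by (simp add: algebra_simps)
      then have "S \<le> ennreal (1 - \<eta>) * M"
        using s m \<eta> by (simp flip: ennreal_mult)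
      then show ?thesis
        by (simp add: S_def M_def)
    qed
  qed
  then show "\<exists>\<delta>>0. \<forall>u\<in>weakly_differentiable \<Omega>. \<forall>v\<in>weakly_differentiable \<Omega>.
      ennreal \<epsilon> * ((grad_modular \<Omega> p u + grad_modular \<Omega> p v) / 2) \<le> grad_modular \<Omega> p ((1/2) *\<^sub>R (u - v)) \<longrightarrow>
      grad_modular \<Omega> p ((1/2) *\<^sub>R (u + v)) \<le> ennreal (1 - \<delta>) * ((grad_modular \<Omega> p u + grad_modular \<Omega> p v) / 2)"
    using \<eta>(1) by blast
qed

theorem theorem5p4:
  fixes \<Omega> :: "(real ^ 'n) set" and p :: "real ^ 'n \<Rightarrow> real"
  assumes "open \<Omega>" and "connected \<Omega>" and "\<Omega> \<noteq> {}"
    and "p \<in> exponents \<Omega>"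
    and "AE x in lebesgue_on \<Omega>. ereal (p x) < \<infinity>"
  shows "convex_pseudomodular_on (W1p \<Omega> p) (grad_modular \<Omega> p) \<and>
         (exponent_inf \<Omega> p > 1 \<longrightarrow> UC_star_on (W1p \<Omega> p) (grad_modular \<Omega> p))"
proof (intro conjI impI)
  have p: "p \<in> borel_measurable (lebesgue_on \<Omega>)" "\<And>x. x \<in> \<Omega> \<Longrightarrow> 1 \<le> p x"
    using assms(4) by (auto simp: exponents_def intro: less_imp_le)
  have sub: "W1p \<Omega> p \<subseteq> weakly_differentiable \<Omega>"
    by (auto simp: W1p_def weakly_differentiable_def)
  show "convex_pseudomodular_on (W1p \<Omega> p) (grad_modular \<Omega> p)"
    using convex_pseudomodular_grad_modular[OF assms(1) p] subspace_W1p[OF assms(1) p] sub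
    by (rule convex_pseudomodular_on_subset)
  assume "1 < exponent_inf \<Omega> p"
  then obtain q where q: "1 < ereal q" "ereal q < exponent_inf \<Omega> p"
    using ereal_dense2[of 1 "exponent_inf \<Omega> p"] by auto
  have "q \<le> p x" if "x \<in> \<Omega>" for x
  proof -
    have "exponent_inf \<Omega> p \<le> ereal (p x)"
      unfolding exponent_inf_def using that by (rule INF_lower)
    then show ?thesis
      using q(2) by (simp flip: ereal_less_eq(3))
  qed
  then have "UC_star_on (weakly_differentiable \<Omega>) (grad_modular \<Omega> p)"
    using q(1) by (intro UC_star_grad_modular[OF assms(1) p(1)]) auto
  then show "UC_star_on (W1p \<Omega> p) (grad_modular \<Omega> p)"
    using sub by (rule UC_star_on_subset)
qed

end
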